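(* The problems \textsc{Cluster Deletion} and \textsc{Strong Triadic Closure} (i) do not correspond on the class of $H$-free graphs for $H\in\{3K_1, C_4, 2K_2, \text{co-paw}, \text{co-diamond}, K_4, 4K_1, \text{claw}, \text{co-claw}\}$, and (ii) correspond on the class of $H$-free graphs for $H\in\{K_3, P_3, K_2+K_1, P_4, \text{diamond}, \text{paw}\}$.
   Context: All graphs are finite, undirected and simple. A labeling of $G=(V,E)$ is a partition $(S_L,W_L)$ of $E$ into strong and weak edges; it is an STC-labeling if there are no strong edges $\{u,v\},\{v,w\}\in S_L$ with $\{u,w\}\notin E$, and it is optimal if $|W_L|$ is minimum among all STC-labelings of $G$. A cluster labeling is an STC-labeling in which $S_L$ is the edge set of a subgraph of $G$ that is a disjoint union of cliques (so $S_L$ arises from a \textsc{Cluster Deletion} solution). The two problems correspond on a graph class $\Pi$ if every graph in $\Pi$ has a cluster labeling that is an optimal STC-labeling. A graph is $H$-free if it has no induced subgraph isomorphic to $H$. Small graphs: $K_n$ complete graph, $P_n$ path on $n$ vertices, $C_4$ cycle on 4 vertices, $sK_1$ edgeless graph on $s$ vertices, $K_2+K_1$ an edge plus an isolated vertex, $2K_2$ two disjoint edges, claw $=K_{1,3}$, paw = triangle with a pendant vertex attached to one triangle vertex, diamond = $K_4$ minus one edge, co-claw = triangle plus an isolated vertex, co-paw = $P_3$ plus an isolated vertex, co-diamond = an edge plus two isolated vertices. *)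

theory Defs
  imports Main "HOL-Library.Ramsey" "HOL-Library.Disjoint_Sets" "HOL-Library.Infinite_Typeclass"
begin

section \<open>Finite simple graphs\<close>

datatype 'a graph = Graph (verts: "'a set") (edges: "'a set set")

text \<open>Below, \<open>[A]\<^bsup>2\<^esup>\<close> is the library's set of two-element subsets of \<open>A\<close>.\<close>

definition simple_graph :: "'a graph \<Rightarrow> bool" where
  "simple_graph G \<longleftrightarrow> finite (verts G) \<and> edges G \<subseteq> [verts G]\<^bsup>2\<^esup>"

definition subgraph :: "'a graph \<Rightarrow> 'a graph \<Rightarrow> bool" where
  "subgraph H G \<longleftrightarrow> verts H \<subseteq> verts G \<and> edges H \<subseteq> edges G"

definition induced_subgraph :: "'a graph \<Rightarrow> 'a set \<Rightarrow> 'a graph" where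
  "induced_subgraph G U = Graph U {e \<in> edges G. e \<subseteq> U}"

definition graph_iso :: "'a graph \<Rightarrow> 'b graph \<Rightarrow> bool" where
  "graph_iso G H \<longleftrightarrow> (\<exists>f. bij_betw f (verts G) (verts H) \<and> edges H = (\<lambda>e. f ` e) ` edges G)"

definition free_graphs :: "'b graph \<Rightarrow> 'a graph set" where
  "free_graphs H =
    {G. simple_graph G \<and> \<not> (\<exists>U \<subseteq> verts G. graph_iso (induced_subgraph G U) H)}"

definition disjoint_union_of_cliques :: "'a graph \<Rightarrow> bool" where
  "disjoint_union_of_cliques G \<longleftrightarrow>
    (\<exists>P. partition_on (verts G) P \<and> edges G = (\<Union>C\<in>P. [C]\<^bsup>2\<^esup>))"


section \<open>Labelings\<close>

text \<open>The strong part \<open>S\<close> or the weak part \<open>W\<close> may be empty.\<close>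

definition labeling :: "'a graph \<Rightarrow> 'a set set \<Rightarrow> 'a set set \<Rightarrow> bool" where
  "labeling G S W \<longleftrightarrow> S \<union> W = edges G \<and> S \<inter> W = {}"

text \<open>The condition \<open>u \<noteq> w\<close> says that the two strong edges are distinct.\<close>

definition stc_labeling :: "'a graph \<Rightarrow> 'a set set \<Rightarrow> 'a set set \<Rightarrow> bool" where
  "stc_labeling G S W \<longleftrightarrow> labeling G S W \<and>
    \<not> (\<exists>u v w. u \<noteq> w \<and> {u, v} \<in> S \<and> {v, w} \<in> S \<and> {u, w} \<notin> edges G)"

definition optimal_stc_labeling :: "'a graph \<Rightarrow> 'a set set \<Rightarrow> 'a set set \<Rightarrow> bool" where
  "optimal_stc_labeling G S W \<longleftrightarrow> stc_labeling G S W \<and>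
    (\<forall>S' W'. stc_labeling G S' W' \<longrightarrow> card W \<le> card W')"

definition cluster_labeling :: "'a graph \<Rightarrow> 'a set set \<Rightarrow> 'a set set \<Rightarrow> bool" where
  "cluster_labeling G S W \<longleftrightarrow> stc_labeling G S W \<and>
    (\<exists>H. subgraph H G \<and> disjoint_union_of_cliques H \<and> edges H = S)"

definition correspond_on :: "'a graph set \<Rightarrow> bool" where
  "correspond_on \<G> \<longleftrightarrow>
    (\<forall>G\<in>\<G>. \<exists>S W. cluster_labeling G S W \<and> optimal_stc_labeling G S W)"


section \<open>Small graphs\<close>

definition complete_graph :: "nat \<Rightarrow> nat graph" where
  "complete_graph n = Graph {..<n} ([{..<n}]\<^bsup>2\<^esup>)"

definition path_graph :: "nat \<Rightarrow> nat graph" where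
  "path_graph n = Graph {..<n} {{i, Suc i} | i. Suc i < n}"

definition edgeless_graph :: "nat \<Rightarrow> nat graph" where
  "edgeless_graph s = Graph {..<s} {}"

definition C4 :: "nat graph" where
  "C4 = Graph {0, 1, 2, 3} {{0, 1}, {1, 2}, {2, 3}, {3, 0}}"

definition K2_plus_K1 :: "nat graph" where
  "K2_plus_K1 = Graph {0, 1, 2} {{0, 1}}"

definition two_K2 :: "nat graph" where
  "two_K2 = Graph {0, 1, 2, 3} {{0, 1}, {2, 3}}"

definition claw :: "nat graph" where
  "claw = Graph {0, 1, 2, 3} {{0, 1}, {0, 2}, {0, 3}}"

definition paw :: "nat graph" where
  "paw = Graph {0, 1, 2, 3} {{0, 1}, {0, 2}, {1, 2}, {2, 3}}"

definition diamond :: "nat graph" where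
  "diamond = Graph {0, 1, 2, 3} {{0, 1}, {0, 2}, {0, 3}, {1, 2}, {1, 3}}"

definition co_claw :: "nat graph" where
  "co_claw = Graph {0, 1, 2, 3} {{0, 1}, {0, 2}, {1, 2}}"

definition co_paw :: "nat graph" where
  "co_paw = Graph {0, 1, 2, 3} {{0, 1}, {1, 2}}"

definition co_diamond :: "nat graph" where
  "co_diamond = Graph {0, 1, 2, 3} {{0, 1}}"

end

theory Submission
  imports Defs
begin

text \<open>
  Correspondence.  In a diamond-free graph every connected component of strong edges is a clique,
  so completing the components costs nothing.  For a graph without induced \<open>P\<^sub>4\<close>, the vertices can
  be arranged in a Young diagram whose rows are cliques and whose columns are independent sets: such
  a graph splits as a disjoint union or a join, and the diagrams of the two parts are merged by rows
  or by columns.  The rows are an optimal solution.  Indeed, in a join the strong edges between a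
  column of one part and a column of the other form a matching, whose size is at most the length of
  the shorter column, and that many rows meet both columns.  In a paw-free graph, the vertices on
  triangles induce a graph without induced \<open>P\<^sub>4\<close> and are not adjacent to the remaining vertices,
  which induce a triangle-free graph.

  Non-correspondence.  The complement of \<open>C\<^sub>7\<close> is free of all the listed graphs but \<open>C\<^sub>4\<close>, and the
  7 pairs at distance two on the cycle form an STC-labeling.  It has no clique of size 4, so 7
  cluster edges would need a partition of the 7 vertices into triangles.  For \<open>C\<^sub>4\<close>, attach to each
  of the four triangles of a \<open>K\<^sub>4\<close> a vertex; here 8 strong edges are possible, but a cluster with \<open>k\<close>
  vertices in the \<open>K\<^sub>4\<close> has at most \<open>2k\<close> edges, with equality only for \<open>k \<in> {0, 3}\<close>.
\<close>

section \<open>STC-labelings and clusters as vertex classes\<close>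

definition stc_set :: "'a set set \<Rightarrow> 'a set set \<Rightarrow> bool" where
  "stc_set E S \<longleftrightarrow> S \<subseteq> E \<and>
    (\<forall>u v w. u \<noteq> w \<longrightarrow> {u, v} \<in> S \<longrightarrow> {v, w} \<in> S \<longrightarrow> {u, w} \<in> E)"

definition class_pairs :: "'a set \<Rightarrow> ('a \<Rightarrow> 'b) \<Rightarrow> 'a set set" where
  "class_pairs V r = {{x, y} | x y. x \<in> V \<and> y \<in> V \<and> x \<noteq> y \<and> r x = r y}"

text \<open>The set \<open>E\<close> may contain pairs outside \<open>V\<close>. Since strong sets
  and clusters are confined to pairs within \<open>V\<close>, the predicate speaks of the subgraph
  induced by \<open>V\<close>, so one \<open>E\<close> serves all parts of a graph. Maximising
  strong edges replaces minimising weak ones.\<close>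

definition cluster_solvable :: "'a set \<Rightarrow> 'a set set \<Rightarrow> bool" where
  "cluster_solvable V E \<longleftrightarrow> (\<exists>r :: 'a \<Rightarrow> nat. class_pairs V r \<subseteq> E \<and>
    (\<forall>S. stc_set E S \<longrightarrow> S \<subseteq> [V]\<^bsup>2\<^esup> \<longrightarrow> card S \<le> card (class_pairs V r)))"

lemma stc_setD: "stc_set E S \<Longrightarrow> {u, v} \<in> S \<Longrightarrow> {v, w} \<in> S \<Longrightarrow> u \<noteq> w \<Longrightarrow> {u, w} \<in> E"
  unfolding stc_set_def by blast

lemma stc_set_subset: "stc_set E S \<Longrightarrow> T \<subseteq> S \<Longrightarrow> stc_set E T"
  unfolding stc_set_def by blast

lemma doubleton_in_class_pairs [simp]:
  "{x, y} \<in> class_pairs V r \<longleftrightarrow> x \<in> V \<and> y \<in> V \<and> x \<noteq> y \<and> r x = r y"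
  unfolding class_pairs_def by (auto simp: doubleton_eq_iff)

lemma class_pairs_subset: "class_pairs V r \<subseteq> [V]\<^bsup>2\<^esup>"
  unfolding class_pairs_def by auto

lemma nsets_2_subsetI: "S \<subseteq> [V]\<^bsup>2\<^esup> \<Longrightarrow> (\<And>x y. {x, y} \<in> S \<Longrightarrow> {x, y} \<in> T) \<Longrightarrow> S \<subseteq> T"
  by (auto simp: nsets_2_eq subset_iff)

lemma nsets_2_eqI:
  assumes "S \<subseteq> [V]\<^bsup>2\<^esup>" "T \<subseteq> [V]\<^bsup>2\<^esup>" "\<And>x y. {x, y} \<in> S \<longleftrightarrow> {x, y} \<in> T"
  shows "S = T"
  using nsets_2_subsetI[OF assms(1), of T] nsets_2_subsetI[OF assms(2), of S] assms(3) by blast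

lemma class_pairs_cong:
  assumes "\<And>x y. x \<in> V \<Longrightarrow> y \<in> V \<Longrightarrow> r x = r y \<longleftrightarrow> r' x = r' y"
  shows "class_pairs V r = class_pairs V r'"
  by (rule nsets_2_eqI[OF class_pairs_subset class_pairs_subset]) (use assms in auto)

text \<open>Only finitely many cluster names occur on \<open>V\<close>, so names of any type can be
  replaced injectively by natural numbers without changing the classes. Tagged numbers or sets of
  vertices can thus serve as names.\<close>

lemma cluster_solvableI:
  fixes r :: "'a \<Rightarrow> 'b"
  assumes "finite V" "class_pairs V r \<subseteq> E"
    and "\<And>S. stc_set E S \<Longrightarrow> S \<subseteq> [V]\<^bsup>2\<^esup> \<Longrightarrow> card S \<le> card (class_pairs V r)"
  shows "cluster_solvable V E"
proof -
  obtain g :: "'b \<Rightarrow> nat" where g: "inj_on g (r ` V)"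
    using finite_imp_inj_to_nat_seg[of "r ` V"] assms(1) by auto
  have "class_pairs V (g \<circ> r) = class_pairs V r"
    by (rule class_pairs_cong) (use g in \<open>auto simp: inj_on_def\<close>)
  then show ?thesis
    unfolding cluster_solvable_def using assms(2,3) by metis
qed

lemma stc_set_class_pairs:
  assumes "class_pairs V r \<subseteq> E"
  shows "stc_set E (class_pairs V r)"
  unfolding stc_set_def using assms by (auto intro!: subsetD[OF assms])

lemma class_pairs_disjoint_union_of_cliques:
  "disjoint_union_of_cliques (Graph V (class_pairs V r))"
proof -
  define R where "R = {(x, y). x \<in> V \<and> y \<in> V \<and> r x = r y}"
  have "equiv V R"
    unfolding R_def equiv_def refl_on_def sym_def trans_def by auto
  then have "partition_on V (V // R)"
    by (rule partition_on_quotient)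
  moreover have "class_pairs V r = (\<Union>C\<in>V // R. [C]\<^bsup>2\<^esup>)"
  proof (rule nsets_2_eqI[OF class_pairs_subset])
    show "(\<Union>C\<in>V // R. [C]\<^bsup>2\<^esup>) \<subseteq> [V]\<^bsup>2\<^esup>"
      by (auto simp: quotient_def nsets_def R_def)
    show "{x, y} \<in> class_pairs V r \<longleftrightarrow> {x, y} \<in> (\<Union>C\<in>V // R. [C]\<^bsup>2\<^esup>)" for x y
      by (auto simp: quotient_def R_def)
  qed
  ultimately show ?thesis
    unfolding disjoint_union_of_cliques_def by auto
qed

lemma stc_labeling_iff:
  "stc_labeling G S W \<longleftrightarrow> stc_set (edges G) S \<and> W = edges G - S"
  unfolding stc_labeling_def labeling_def stc_set_def by blast

text \<open>Strong and weak edges together make up the finite set of all edges, so a largest strong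
  set leaves the fewest weak edges.\<close>

lemma correspond_onI:
  assumes "\<And>G. G \<in> \<G> \<Longrightarrow> simple_graph G \<and> cluster_solvable (verts G) (edges G)"
  shows "correspond_on \<G>"
  unfolding correspond_on_def
proof
  fix G assume "G \<in> \<G>"
  then have G: "finite (verts G)" "edges G \<subseteq> [verts G]\<^bsup>2\<^esup>"
    and solv: "cluster_solvable (verts G) (edges G)"
    using assms by (auto simp: simple_graph_def)
  then have finE: "finite (edges G)"
    by (meson finite_imp_finite_nsets finite_subset)
  from solv obtain r :: "'a \<Rightarrow> nat" where r: "class_pairs (verts G) r \<subseteq> edges G"
    and opt: "\<And>S. stc_set (edges G) S \<Longrightarrow> S \<subseteq> [verts G]\<^bsup>2\<^esup> \<Longrightarrow> card S \<le> card (class_pairs (verts G) r)"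
    unfolding cluster_solvable_def by blast
  let ?S = "class_pairs (verts G) r"
  have stc: "stc_labeling G ?S (edges G - ?S)"
    using stc_set_class_pairs[OF r] by (simp add: stc_labeling_iff)
  have "cluster_labeling G ?S (edges G - ?S)"
    unfolding cluster_labeling_def
    using stc class_pairs_disjoint_union_of_cliques[of "verts G" r] r
    by (metis graph.sel order_refl subgraph_def)
  moreover have "card (edges G - ?S) \<le> card W'" if "stc_labeling G S' W'" for S' W'
  proof -
    have S': "stc_set (edges G) S'" "W' = edges G - S'" "S' \<subseteq> edges G"
      using that by (auto simp: stc_labeling_iff stc_set_def)
    then have "card S' \<le> card ?S"
      using opt G(2) by blast
    moreover have "card W' = card (edges G) - card S'"
      using S' finE by (metis card_Diff_subset finite_subset)
    moreover have "card (edges G - ?S) = card (edges G) - card ?S"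
      using r finE by (metis card_Diff_subset finite_subset)
    ultimately show ?thesis by linarith
  qed
  ultimately show "\<exists>S W. cluster_labeling G S W \<and> optimal_stc_labeling G S W"
    using stc unfolding optimal_stc_labeling_def by blast
qed

section \<open>Combining two disjoint vertex sets\<close>

text \<open>Pairs across are counted as ordered pairs starting in \<open>V\<^sub>1\<close>;
  disjointness makes this orientation unique.\<close>

lemma card_nsets_2_Un:
  assumes fin: "finite V\<^sub>1" "finite V\<^sub>2" and disj: "V\<^sub>1 \<inter> V\<^sub>2 = {}"
    and T: "T \<subseteq> [V\<^sub>1 \<union> V\<^sub>2]\<^bsup>2\<^esup>"
  shows "card T = card (T \<inter> [V\<^sub>1]\<^bsup>2\<^esup>) + card (T \<inter> [V\<^sub>2]\<^bsup>2\<^esup>) +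
    card {(x, y). x \<in> V\<^sub>1 \<and> y \<in> V\<^sub>2 \<and> {x, y} \<in> T}"
proof -
  let ?B = "{(x, y). x \<in> V\<^sub>1 \<and> y \<in> V\<^sub>2 \<and> {x, y} \<in> T}"
  let ?X = "(\<lambda>(x, y). {x, y}) ` ?B"
  have finT: "finite T"
    using T fin by (meson finite_UnI finite_imp_finite_nsets finite_subset)
  have "?B \<subseteq> V\<^sub>1 \<times> V\<^sub>2" by auto
  then have finB: "finite ?B"
    using fin by (meson finite_SigmaI finite_subset)
  have inj: "inj_on (\<lambda>(x, y). {x, y}) ?B"
    using disj by (auto simp: inj_on_def doubleton_eq_iff)
  have T_eq: "T = (T \<inter> [V\<^sub>1]\<^bsup>2\<^esup> \<union> T \<inter> [V\<^sub>2]\<^bsup>2\<^esup>) \<union> ?X"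
  proof (rule nsets_2_eqI[OF T])
    show "(T \<inter> [V\<^sub>1]\<^bsup>2\<^esup> \<union> T \<inter> [V\<^sub>2]\<^bsup>2\<^esup>) \<union> ?X \<subseteq> [V\<^sub>1 \<union> V\<^sub>2]\<^bsup>2\<^esup>"
      using T by auto
    fix x y
    have X: "{u, v} \<in> ?X" if "{u, v} \<in> T" "u \<in> V\<^sub>1" "v \<in> V\<^sub>2" for u v
      by (rule image_eqI[where x = "(u, v)"]) (use that in auto)
    show "{x, y} \<in> T \<longleftrightarrow> {x, y} \<in> (T \<inter> [V\<^sub>1]\<^bsup>2\<^esup> \<union> T \<inter> [V\<^sub>2]\<^bsup>2\<^esup>) \<union> ?X"
    proof
      assume xy: "{x, y} \<in> T"
      then have "x \<in> V\<^sub>1 \<union> V\<^sub>2" "y \<in> V\<^sub>1 \<union> V\<^sub>2" "x \<noteq> y"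
        using subsetD[OF T xy] by simp_all
      then consider "x \<in> V\<^sub>1" "y \<in> V\<^sub>1" | "x \<in> V\<^sub>2" "y \<in> V\<^sub>2" | "x \<in> V\<^sub>1" "y \<in> V\<^sub>2" | "y \<in> V\<^sub>1" "x \<in> V\<^sub>2"
        by blast
      then show "{x, y} \<in> (T \<inter> [V\<^sub>1]\<^bsup>2\<^esup> \<union> T \<inter> [V\<^sub>2]\<^bsup>2\<^esup>) \<union> ?X"
      proof cases
        case 3
        then show ?thesis using X[OF xy] by blast
      next
        case 4
        then show ?thesis using X[of y x] xy by (simp add: insert_commute)
      qed (use xy \<open>x \<noteq> y\<close> in simp_all)
    qed auto
  qed
  have d1: "(T \<inter> [V\<^sub>1]\<^bsup>2\<^esup> \<union> T \<inter> [V\<^sub>2]\<^bsup>2\<^esup>) \<inter> ?X = {}"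
    using disj by auto
  have d2: "(T \<inter> [V\<^sub>1]\<^bsup>2\<^esup>) \<inter> (T \<inter> [V\<^sub>2]\<^bsup>2\<^esup>) = {}"
    using disj by (auto simp: nsets_2_eq)
  have "card T = card (T \<inter> [V\<^sub>1]\<^bsup>2\<^esup> \<union> T \<inter> [V\<^sub>2]\<^bsup>2\<^esup>) + card ?X"
    by (subst T_eq, rule card_Un_disjoint) (use finT finB d1 in auto)
  also have "card (T \<inter> [V\<^sub>1]\<^bsup>2\<^esup> \<union> T \<inter> [V\<^sub>2]\<^bsup>2\<^esup>) = card (T \<inter> [V\<^sub>1]\<^bsup>2\<^esup>) + card (T \<inter> [V\<^sub>2]\<^bsup>2\<^esup>)"
    by (rule card_Un_disjoint) (use finT d2 in auto)
  also have "card ?X = card ?B"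
    by (rule card_image[OF inj])
  finally show ?thesis .
qed

lemma class_pairs_restrict:
  assumes "U \<subseteq> V" "\<And>x y. x \<in> U \<Longrightarrow> y \<in> U \<Longrightarrow> r x = r y \<longleftrightarrow> r' x = r' y"
  shows "class_pairs V r \<inter> [U]\<^bsup>2\<^esup> = class_pairs U r'"
proof (rule nsets_2_eqI[OF _ class_pairs_subset])
  show "class_pairs V r \<inter> [U]\<^bsup>2\<^esup> \<subseteq> [U]\<^bsup>2\<^esup>" by simp
qed (use assms in auto)

text \<open>The given bounds settle the pairs within each part, so only the pairs across remain to
  be compared. On each part \<open>r\<close> has to induce the same classes as the old naming, but
  may use other names.\<close>

lemma card_le_card_class_pairs_Un:
  assumes fin: "finite V\<^sub>1" "finite V\<^sub>2" and disj: "V\<^sub>1 \<inter> V\<^sub>2 = {}"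
    and bound1: "\<And>S. stc_set E S \<Longrightarrow> S \<subseteq> [V\<^sub>1]\<^bsup>2\<^esup> \<Longrightarrow> card S \<le> card (class_pairs V\<^sub>1 r\<^sub>1)"
    and bound2: "\<And>S. stc_set E S \<Longrightarrow> S \<subseteq> [V\<^sub>2]\<^bsup>2\<^esup> \<Longrightarrow> card S \<le> card (class_pairs V\<^sub>2 r\<^sub>2)"
    and r1: "\<And>x y. x \<in> V\<^sub>1 \<Longrightarrow> y \<in> V\<^sub>1 \<Longrightarrow> r x = r y \<longleftrightarrow> r\<^sub>1 x = r\<^sub>1 y"
    and r2: "\<And>x y. x \<in> V\<^sub>2 \<Longrightarrow> y \<in> V\<^sub>2 \<Longrightarrow> r x = r y \<longleftrightarrow> r\<^sub>2 x = r\<^sub>2 y"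
    and S: "stc_set E S" "S \<subseteq> [V\<^sub>1 \<union> V\<^sub>2]\<^bsup>2\<^esup>"
    and cross: "card {(x, y). x \<in> V\<^sub>1 \<and> y \<in> V\<^sub>2 \<and> {x, y} \<in> S}
      \<le> card {(x, y). x \<in> V\<^sub>1 \<and> y \<in> V\<^sub>2 \<and> r x = r y}"
  shows "card S \<le> card (class_pairs (V\<^sub>1 \<union> V\<^sub>2) r)"
proof -
  let ?T = "class_pairs (V\<^sub>1 \<union> V\<^sub>2) r"
  have "?T \<inter> [V\<^sub>1]\<^bsup>2\<^esup> = class_pairs V\<^sub>1 r\<^sub>1" "?T \<inter> [V\<^sub>2]\<^bsup>2\<^esup> = class_pairs V\<^sub>2 r\<^sub>2"
    by (rule class_pairs_restrict; use r1 r2 in auto)+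
  moreover have "{(x, y). x \<in> V\<^sub>1 \<and> y \<in> V\<^sub>2 \<and> {x, y} \<in> ?T} = {(x, y). x \<in> V\<^sub>1 \<and> y \<in> V\<^sub>2 \<and> r x = r y}"
    using disj by auto
  moreover have "card (S \<inter> [V\<^sub>1]\<^bsup>2\<^esup>) \<le> card (class_pairs V\<^sub>1 r\<^sub>1)"
    by (rule bound1) (use S in \<open>auto intro: stc_set_subset\<close>)
  moreover have "card (S \<inter> [V\<^sub>2]\<^bsup>2\<^esup>) \<le> card (class_pairs V\<^sub>2 r\<^sub>2)"
    by (rule bound2) (use S in \<open>auto intro: stc_set_subset\<close>)
  ultimately show ?thesis
    using card_nsets_2_Un[OF fin disj S(2)] card_nsets_2_Un[OF fin disj class_pairs_subset, of r] cross
    by simp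
qed

text \<open>No strong edge can cross, so the two solutions are put side by side. The Boolean tag
  keeps clusters of different parts from sharing a name.\<close>

lemma cluster_solvable_Un:
  assumes fin: "finite V\<^sub>1" "finite V\<^sub>2" and disj: "V\<^sub>1 \<inter> V\<^sub>2 = {}"
    and solv: "cluster_solvable V\<^sub>1 E" "cluster_solvable V\<^sub>2 E"
    and no_edge: "\<And>x y. x \<in> V\<^sub>1 \<Longrightarrow> y \<in> V\<^sub>2 \<Longrightarrow> {x, y} \<notin> E"
  shows "cluster_solvable (V\<^sub>1 \<union> V\<^sub>2) E"
proof -
  obtain r\<^sub>1 :: "'a \<Rightarrow> nat" where r1: "class_pairs V\<^sub>1 r\<^sub>1 \<subseteq> E"
    and b1: "\<And>S. stc_set E S \<Longrightarrow> S \<subseteq> [V\<^sub>1]\<^bsup>2\<^esup> \<Longrightarrow> card S \<le> card (class_pairs V\<^sub>1 r\<^sub>1)"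
    using solv(1) unfolding cluster_solvable_def by blast
  obtain r\<^sub>2 :: "'a \<Rightarrow> nat" where r2: "class_pairs V\<^sub>2 r\<^sub>2 \<subseteq> E"
    and b2: "\<And>S. stc_set E S \<Longrightarrow> S \<subseteq> [V\<^sub>2]\<^bsup>2\<^esup> \<Longrightarrow> card S \<le> card (class_pairs V\<^sub>2 r\<^sub>2)"
    using solv(2) unfolding cluster_solvable_def by blast
  define r where "r x = (if x \<in> V\<^sub>1 then (True, r\<^sub>1 x) else (False, r\<^sub>2 x))" for x
  have in1: "x \<in> V\<^sub>1 \<Longrightarrow> r x = (True, r\<^sub>1 x)" for x by (simp add: r_def)
  have in2: "x \<in> V\<^sub>2 \<Longrightarrow> r x = (False, r\<^sub>2 x)" for x using disj by (auto simp: r_def)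
  show ?thesis
  proof (rule cluster_solvableI[where r = r])
    show "finite (V\<^sub>1 \<union> V\<^sub>2)" using fin by simp
    show "class_pairs (V\<^sub>1 \<union> V\<^sub>2) r \<subseteq> E"
    proof (rule nsets_2_subsetI[OF class_pairs_subset])
      fix x y assume "{x, y} \<in> class_pairs (V\<^sub>1 \<union> V\<^sub>2) r"
      then have "{x, y} \<in> class_pairs V\<^sub>1 r\<^sub>1 \<or> {x, y} \<in> class_pairs V\<^sub>2 r\<^sub>2"
        by (auto simp: in1 in2)
      then show "{x, y} \<in> E" using r1 r2 by blast
    qed
    fix S assume S: "stc_set E S" "S \<subseteq> [V\<^sub>1 \<union> V\<^sub>2]\<^bsup>2\<^esup>"
    have "{(x, y). x \<in> V\<^sub>1 \<and> y \<in> V\<^sub>2 \<and> {x, y} \<in> S} = {}"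
      using S(1) no_edge unfolding stc_set_def by auto
    then have "card {(x, y). x \<in> V\<^sub>1 \<and> y \<in> V\<^sub>2 \<and> {x, y} \<in> S}
      \<le> card {(x, y). x \<in> V\<^sub>1 \<and> y \<in> V\<^sub>2 \<and> r x = r y}"
      by (simp only: card.empty)
    then show "card S \<le> card (class_pairs (V\<^sub>1 \<union> V\<^sub>2) r)"
      by (intro card_le_card_class_pairs_Un[OF fin disj b1 b2 _ _ S]) (auto simp: in1 in2)
  qed
qed

section \<open>Diamond-free graphs\<close>

text \<open>Take an STC set \<open>M\<close> of maximum size. Its connected components are cliques
  of \<open>E\<close>, and the pairs within components include \<open>M\<close>, so they are at
  least as many as the edges of any STC set. A simple graph without triangles satisfies the
  hypothesis vacuously.\<close>

lemma diamond_free_cluster_solvable: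
  assumes fin: "finite V"
    and diamond_free: "\<And>a b x y. \<lbrakk>a \<in> V; b \<in> V; x \<in> V; y \<in> V; {a, b} \<in> E; {a, x} \<in> E; {a, y} \<in> E;
      {b, x} \<in> E; {b, y} \<in> E; x \<noteq> y\<rbrakk> \<Longrightarrow> {x, y} \<in> E"
  shows "cluster_solvable V E"
proof -
  have bound: "card S < Suc (card ([V]\<^bsup>2\<^esup>))" if "S \<subseteq> [V]\<^bsup>2\<^esup>" for S
    using card_mono[OF finite_imp_finite_nsets[OF fin] that] by linarith
  have "\<exists>M. (stc_set E M \<and> M \<subseteq> [V]\<^bsup>2\<^esup>) \<and>
      (\<forall>S. stc_set E S \<and> S \<subseteq> [V]\<^bsup>2\<^esup> \<longrightarrow> card S \<le> card M)"
    by (rule ex_has_greatest_nat[where k = "{}" and P = "\<lambda>S. stc_set E S \<and> S \<subseteq> [V]\<^bsup>2\<^esup>"])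
      (use bound in \<open>auto simp: stc_set_def\<close>)
  then obtain M where M: "stc_set E M" "M \<subseteq> [V]\<^bsup>2\<^esup>"
    and max: "\<And>S. stc_set E S \<Longrightarrow> S \<subseteq> [V]\<^bsup>2\<^esup> \<Longrightarrow> card S \<le> card M"
    by blast
  have MV: "x \<in> V" "y \<in> V" "x \<noteq> y" "{x, y} \<in> E" if "{x, y} \<in> M" for x y
    using subsetD[OF M(2) that] that M(1) unfolding stc_set_def by auto
  define R where "R = {(x, y). {x, y} \<in> M}\<^sup>*"
  have "sym R"
    unfolding R_def by (rule sym_rtrancl) (auto simp: sym_def insert_commute)
  then have equivR: "equiv UNIV R"
    by (simp add: equiv_def R_def refl_rtrancl trans_rtrancl)
  txt \<open>If a strong path ends with \<open>w, y, z\<close>, then its first vertex and \<open>z\<close> are both adjacent to \<open>w\<close>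
    and \<open>y\<close>, so they are adjacent to each other, for otherwise there would be a diamond.\<close>
  have path: "x = y \<or> (\<exists>w. {w, y} \<in> M \<and> (w = x \<or> {x, w} \<in> E) \<and> {x, y} \<in> E)" if "(x, y) \<in> R" for x y
    using that unfolding R_def
  proof (induction rule: rtrancl_induct)
    case base
    then show ?case by simp
  next
    case (step y z)
    then have yz: "{y, z} \<in> M" by simp
    note zE = MV[OF yz]
    show ?case
    proof (cases "x = y")
      case True
      then show ?thesis using yz zE by blast
    next
      case False
      then obtain w where w: "{w, y} \<in> M" "w = x \<or> {x, w} \<in> E" "{x, y} \<in> E"
        using step.IH by blast
      note wE = MV[OF w(1)]
      have "{x, z} \<in> E" if "x \<noteq> z"
      proof (cases "w = x \<or> w = z")
        case True
        then show ?thesis using stc_setD[OF M(1) w(1) yz] w that by auto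
      next
        case False
        have wz: "{w, z} \<in> E" using stc_setD[OF M(1) w(1) yz] False by simp
        have "x \<in> V"
          using \<open>(x, y) \<in> {(x, y). {x, y} \<in> M}\<^sup>*\<close> wE(2)
          by (induction rule: converse_rtrancl_induct) (auto dest: MV)
        then show ?thesis
          using diamond_free[of w y x z] wE zE w wz False that by (simp add: insert_commute)
      qed
      then show ?thesis using yz w(3) by (auto simp: insert_commute)
    qed
  qed
  let ?r = "\<lambda>x. R `` {x}"
  have r_iff: "?r x = ?r y \<longleftrightarrow> (x, y) \<in> R" for x y
    using equiv_class_eq_iff[OF equivR] by auto
  show ?thesis
  proof (rule cluster_solvableI[where r = ?r, OF fin])
    show "class_pairs V ?r \<subseteq> E"
      by (rule nsets_2_subsetI[OF class_pairs_subset]) (auto simp: r_iff dest: path)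
    have "M \<subseteq> class_pairs V ?r"
      by (rule nsets_2_subsetI[OF M(2)]) (auto simp: r_iff dest: MV, auto simp: R_def)
    moreover have "finite (class_pairs V ?r)"
      using fin class_pairs_subset by (meson finite_imp_finite_nsets finite_subset)
    ultimately have "card M \<le> card (class_pairs V ?r)"
      by (simp add: card_mono)
    then show "card S \<le> card (class_pairs V ?r)" if "stc_set E S" "S \<subseteq> [V]\<^bsup>2\<^esup>" for S
      using max[OF that] by linarith
  qed
qed

section \<open>Graphs without induced \<open>P\<^sub>4\<close>\<close>

text \<open>\<open>E\<close> is an arbitrary set of sets so that the complement \<open>- E\<close>
  can take its place; distinctness ensures that only two-element sets are tested.\<close>

definition P4_free_on :: "'a set \<Rightarrow> 'a set set \<Rightarrow> bool" where
  "P4_free_on V E \<longleftrightarrow> \<not> (\<exists>a\<in>V. \<exists>b\<in>V. \<exists>c\<in>V. \<exists>d\<in>V. distinct [a, b, c, d] \<and>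
    {a, b} \<in> E \<and> {b, c} \<in> E \<and> {c, d} \<in> E \<and> {a, c} \<notin> E \<and> {a, d} \<notin> E \<and> {b, d} \<notin> E)"

lemma P4_free_on_subset: "P4_free_on V E \<Longrightarrow> U \<subseteq> V \<Longrightarrow> P4_free_on U E"
  unfolding P4_free_on_def by blast

lemma P4_free_onD:
  assumes "P4_free_on V E" "a \<in> V" "b \<in> V" "c \<in> V" "d \<in> V" "distinct [a, b, c, d]"
    "{a, b} \<in> E" "{b, c} \<in> E" "{c, d} \<in> E" "{a, c} \<notin> E" "{a, d} \<notin> E"
  shows "{b, d} \<in> E"
  using assms unfolding P4_free_on_def by blast

text \<open>The path on four vertices is self-complementary: the non-edges of the path
  \<open>a b c d\<close> form the path \<open>b d a c\<close>.\<close>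

lemma P4_free_on_complement:
  assumes "P4_free_on V E"
  shows "P4_free_on V (- E)"
  unfolding P4_free_on_def
proof (rule notI, elim bexE conjE)
  fix a b c d
  assume V: "a \<in> V" "b \<in> V" "c \<in> V" "d \<in> V" and dist: "distinct [a, b, c, d]"
    and E: "{a, b} \<in> - E" "{b, c} \<in> - E" "{c, d} \<in> - E" "{a, c} \<notin> - E" "{a, d} \<notin> - E" "{b, d} \<notin> - E"
  have "distinct [b, d, a, c]" using dist by auto
  moreover have "{b, d} \<in> E" "{d, a} \<in> E" "{a, c} \<in> E" "{b, a} \<notin> E" "{b, c} \<notin> E" "{d, c} \<notin> E"
    using E by (simp_all add: insert_commute)
  ultimately show False
    using P4_free_onD[OF assms V(2,4,1,3)] by blast
qed

text \<open>Let \<open>C\<close> be the component of \<open>w\<close> within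
  \<open>F\<^sub>1\<close>. If \<open>v\<close> has no neighbour in \<open>C\<close>, then
  \<open>C\<close> splits off. Otherwise some edge \<open>x y\<close> of \<open>C\<close> has only
  \<open>x\<close> adjacent to \<open>v\<close>; a neighbour \<open>z\<close> of \<open>v\<close> in
  \<open>F\<^sub>2\<close> would give the induced path \<open>z v x y\<close>, so
  \<open>F\<^sub>2\<close> splits off.\<close>

lemma P4_free_split_insert:
  assumes P4_free: "P4_free_on (insert v (F\<^sub>1 \<union> F\<^sub>2)) E" and v: "v \<notin> F\<^sub>1 \<union> F\<^sub>2"
    and disj: "F\<^sub>1 \<inter> F\<^sub>2 = {}" and "F\<^sub>2 \<noteq> {}"
    and no_edge: "\<And>x y. x \<in> F\<^sub>1 \<Longrightarrow> y \<in> F\<^sub>2 \<Longrightarrow> {x, y} \<notin> E"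
    and w: "w \<in> F\<^sub>1" "{v, w} \<notin> E"
  shows "\<exists>A B. insert v (F\<^sub>1 \<union> F\<^sub>2) = A \<union> B \<and> A \<inter> B = {} \<and> A \<noteq> {} \<and> B \<noteq> {} \<and>
    (\<forall>x\<in>A. \<forall>y\<in>B. {x, y} \<notin> E)"
proof -
  define R where "R = {(x, y). x \<in> F\<^sub>1 \<and> y \<in> F\<^sub>1 \<and> {x, y} \<in> E}"
  define C where "C = {x. (w, x) \<in> R\<^sup>*}"
  have wC: "w \<in> C" by (simp add: C_def)
  have CF: "C \<subseteq> F\<^sub>1"
  proof
    fix x assume "x \<in> C"
    then have "(w, x) \<in> R\<^sup>*" by (simp add: C_def)
    then show "x \<in> F\<^sub>1" by (cases rule: rtranclE) (use w in \<open>auto simp: R_def\<close>)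
  qed
  have closed: "y \<in> C" if "x \<in> C" "y \<in> F\<^sub>1" "{x, y} \<in> E" for x y
  proof -
    have "(x, y) \<in> R" using that CF by (auto simp: R_def)
    then show ?thesis using that(1) unfolding C_def by (auto intro: rtrancl_into_rtrancl)
  qed
  show ?thesis
  proof (cases "\<exists>x\<in>C. {v, x} \<in> E")
    case False
    have "insert v (F\<^sub>1 \<union> F\<^sub>2) = C \<union> (insert v (F\<^sub>1 \<union> F\<^sub>2) - C)" using CF by blast
    moreover have "insert v (F\<^sub>1 \<union> F\<^sub>2) - C \<noteq> {}" using CF v by blast
    moreover have "{x, y} \<notin> E" if "x \<in> C" "y \<in> insert v (F\<^sub>1 \<union> F\<^sub>2) - C" for x y
    proof -
      from that have "y = v \<or> y \<in> F\<^sub>1 \<or> y \<in> F\<^sub>2" by blast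
      then show ?thesis
        using that False closed[of x y] no_edge[of x y] CF by (auto simp: insert_commute)
    qed
    ultimately show ?thesis using wC by (intro exI[of _ C] exI[of _ "insert v (F\<^sub>1 \<union> F\<^sub>2) - C"]) auto
  next
    case True
    then obtain x\<^sub>0 where x0: "x\<^sub>0 \<in> C" "{v, x\<^sub>0} \<in> E" by blast
    \<comment> \<open>A walk in \<open>C\<close> from the non-neighbour \<open>w\<close> of
      \<open>v\<close> to its neighbour \<open>x\<^sub>0\<close> must enter the neighbourhood of
      \<open>v\<close> at some edge.\<close>
    have "\<exists>x y. x \<in> C \<and> y \<in> C \<and> {x, y} \<in> E \<and> {v, x} \<in> E \<and> {v, y} \<notin> E"
    proof (rule ccontr)
      assume no: "\<not> ?thesis"
      have "{v, x} \<notin> E" if "(w, x) \<in> R\<^sup>*" for x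
        using that
      proof (induction rule: rtrancl_induct)
        case base
        then show ?case by (rule w)
      next
        case (step y z)
        then have "y \<in> C" "z \<in> C"
          by (auto simp: C_def intro: rtrancl_into_rtrancl)
        moreover have "{z, y} \<in> E"
          using step.hyps(2) by (simp add: R_def insert_commute)
        ultimately show ?case using no step.IH by blast
      qed
      then show False using x0 by (auto simp: C_def)
    qed
    then obtain x y where xy: "x \<in> C" "y \<in> C" "{x, y} \<in> E" "{v, x} \<in> E" "{v, y} \<notin> E" by blast
    have "{v, z} \<notin> E" if z: "z \<in> F\<^sub>2" for z
    proof
      assume vz: "{v, z} \<in> E"
      have "x \<in> F\<^sub>1" "y \<in> F\<^sub>1" using xy CF by auto
      moreover have "{z, x} \<notin> E" "{z, y} \<notin> E"
        using no_edge[OF \<open>x \<in> F\<^sub>1\<close> z] no_edge[OF \<open>y \<in> F\<^sub>1\<close> z] by (simp_all add: insert_commute)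
      moreover have "x \<noteq> y" using xy by auto
      moreover have "{z, v} \<in> E" using vz by (simp add: insert_commute)
      ultimately show False
        using P4_free_onD[OF P4_free, of z v x y] z v disj xy by auto
    qed
    then have "\<forall>x\<in>F\<^sub>2. \<forall>y\<in>insert v F\<^sub>1. {x, y} \<notin> E"
      using no_edge by (metis insert_commute insert_iff)
    then show ?thesis
      using v disj \<open>F\<^sub>2 \<noteq> {}\<close> by (intro exI[of _ F\<^sub>2] exI[of _ "insert v F\<^sub>1"]) auto
  qed
qed

text \<open>A vertex \<open>v\<close> adjacent to everything is joined to the rest; otherwise it
  misses a vertex of one of the two sides, which may be taken as the first by symmetry.\<close>

lemma P4_free_split_insert':
  assumes P4_free: "P4_free_on (insert v (F\<^sub>1 \<union> F\<^sub>2)) E" and v: "v \<notin> F\<^sub>1 \<union> F\<^sub>2"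
    and disj: "F\<^sub>1 \<inter> F\<^sub>2 = {}" and ne: "F\<^sub>1 \<noteq> {}" "F\<^sub>2 \<noteq> {}"
    and no_edge: "\<And>x y. x \<in> F\<^sub>1 \<Longrightarrow> y \<in> F\<^sub>2 \<Longrightarrow> {x, y} \<notin> E"
  shows "\<exists>A B. insert v (F\<^sub>1 \<union> F\<^sub>2) = A \<union> B \<and> A \<inter> B = {} \<and> A \<noteq> {} \<and> B \<noteq> {} \<and>
    ((\<forall>x\<in>A. \<forall>y\<in>B. {x, y} \<in> E) \<or> (\<forall>x\<in>A. \<forall>y\<in>B. {x, y} \<notin> E))"
proof -
  consider "\<forall>w\<in>F\<^sub>1 \<union> F\<^sub>2. {v, w} \<in> E" | w where "w \<in> F\<^sub>1" "{v, w} \<notin> E" | w where "w \<in> F\<^sub>2" "{v, w} \<notin> E"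
    by blast
  then show ?thesis
  proof cases
    case 1
    then show ?thesis
      using v ne by (intro exI[of _ "{v}"] exI[of _ "F\<^sub>1 \<union> F\<^sub>2"]) auto
  next
    case 2
    show ?thesis
      using P4_free_split_insert[OF P4_free v disj ne(2) no_edge 2] by blast
  next
    case 3
    have "{x, y} \<notin> E" if "x \<in> F\<^sub>2" "y \<in> F\<^sub>1" for x y
      using no_edge[OF that(2,1)] by (simp add: insert_commute)
    then show ?thesis
      using P4_free_split_insert[of v F\<^sub>2 F\<^sub>1 E w] P4_free v disj ne(1) 3 by (metis Int_commute Un_commute)
  qed
qed

text \<open>Induction on the vertices: a split of \<open>F\<close> is extended to the new vertex
  \<open>v\<close>. A join is a disjoint union in the complement \<open>- E\<close>, where the two
  alternatives of the conclusion change places.\<close>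

lemma P4_free_split:
  assumes "finite V" "card V \<ge> 2" "P4_free_on V E"
  shows "\<exists>A B. V = A \<union> B \<and> A \<inter> B = {} \<and> A \<noteq> {} \<and> B \<noteq> {} \<and>
    ((\<forall>x\<in>A. \<forall>y\<in>B. {x, y} \<in> E) \<or> (\<forall>x\<in>A. \<forall>y\<in>B. {x, y} \<notin> E))"
  using assms
proof (induction V rule: finite_induct)
  case empty
  then show ?case by simp
next
  case (insert v F)
  show ?case
  proof (cases "card F \<ge> 2")
    case False
    then have "card F = 1" using insert by simp
    then obtain u where "F = {u}" by (auto simp: card_1_singleton_iff)
    then show ?thesis
      using insert.hyps(2) by (intro exI[of _ "{v}"] exI[of _ "{u}"]) auto
  next
    case True
    then obtain A B where AB: "F = A \<union> B" "A \<inter> B = {}" "A \<noteq> {}" "B \<noteq> {}"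
      and "(\<forall>x\<in>A. \<forall>y\<in>B. {x, y} \<in> E) \<or> (\<forall>x\<in>A. \<forall>y\<in>B. {x, y} \<notin> E)"
      using insert.IH P4_free_on_subset[OF insert.prems(2), of F] by (metis subset_insertI)
    then show ?thesis
    proof (elim disjE)
      assume "\<forall>x\<in>A. \<forall>y\<in>B. {x, y} \<notin> E"
      then show ?thesis
        using P4_free_split_insert'[of v A B E] insert.prems(2) insert.hyps(2) AB by blast
    next
      assume "\<forall>x\<in>A. \<forall>y\<in>B. {x, y} \<in> E"
      then show ?thesis
        using P4_free_split_insert'[of v A B "- E"] P4_free_on_complement[OF insert.prems(2)]
          insert.hyps(2) AB unfolding Compl_iff not_not by blast
    qed
  qed
qed

section \<open>Young diagrams\<close>

text \<open>\<open>r\<close> numbers the rows and \<open>c\<close> merely names the columns: a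
  column of height \<open>h\<close> occupies exactly the rows \<open>0, ..., h - 1\<close>.\<close>

definition columns_initial :: "'a set \<Rightarrow> ('a \<Rightarrow> nat) \<Rightarrow> ('a \<Rightarrow> 'b) \<Rightarrow> bool" where
  "columns_initial V r c \<longleftrightarrow> (\<forall>x\<in>V. \<forall>i<r x. \<exists>y\<in>V. c y = c x \<and> r y = i)"

lemma columns_initialE:
  assumes "columns_initial V r c" "x \<in> V" "i < r x"
  obtains y where "y \<in> V" "c y = c x" "r y = i"
  using assms unfolding columns_initial_def by blast

text \<open>Two vertices in the same row and the same column would be both adjacent and
  non-adjacent. Hence each cell holds at most one vertex, and with \<open>columns_initial\<close>
  the vertices fill a Young diagram once the columns are ordered by height.\<close>

definition cliques_and_independent_sets :: "'a set set \<Rightarrow> 'a set \<Rightarrow> ('a \<Rightarrow> 'b) \<Rightarrow> ('a \<Rightarrow> 'c) \<Rightarrow> bool" where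
  "cliques_and_independent_sets E V r c \<longleftrightarrow> (\<forall>x\<in>V. \<forall>y\<in>V. x \<noteq> y \<longrightarrow>
    (r x = r y \<longrightarrow> {x, y} \<in> E) \<and> (c x = c y \<longrightarrow> {x, y} \<notin> E))"

text \<open>Order the columns by decreasing height and number each by its position. Every column
  before that of \<open>x\<close> is at least as tall and so meets the row of \<open>x\<close>,
  which makes the rows initial segments as well.\<close>

lemma columns_initial_transpose:
  assumes fin: "finite V" and init: "columns_initial V r c"
  obtains c' :: "'a \<Rightarrow> nat" where "\<And>x y. x \<in> V \<Longrightarrow> y \<in> V \<Longrightarrow> c x = c y \<longleftrightarrow> c' x = c' y"
    and "columns_initial V c' r"
proof -
  define I where "I d = r ` {x \<in> V. c x = d}" for d
  \<comment> \<open>The rows of a column form a finite initial segment of the numbers, so the least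
    missing row is the height.\<close>
  define h where "h d = (LEAST i. i \<notin> I d)" for d
  have down: "j \<in> I d" if i: "i \<in> I d" and "j \<le> i" for i j d
  proof (cases "j = i")
    case False
    from i obtain x where x: "x \<in> V" "c x = d" "r x = i" by (auto simp: I_def)
    then have "j < r x" using \<open>j \<le> i\<close> False by simp
    then obtain y where "y \<in> V" "c y = d" "r y = j"
      using columns_initialE[OF init x(1)] x(2) by metis
    then show ?thesis by (auto simp: I_def)
  qed (use i in simp)
  have h: "i \<in> I d \<longleftrightarrow> i < h d" for i d
  proof
    have "\<exists>i. i \<notin> I d"
      using fin by (intro ex_new_if_finite) (simp_all add: I_def)
    then have "h d \<notin> I d" unfolding h_def by (rule LeastI_ex)
    then show "i < h d" if "i \<in> I d" using down[OF that] by (meson linorder_not_le)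
    show "i \<in> I d" if "i < h d" using that not_less_Least unfolding h_def by blast
  qed
  obtain xs\<^sub>0 where xs0: "set xs\<^sub>0 = c ` V" "distinct xs\<^sub>0"
    using fin finite_distinct_list by (metis finite_imageI)
  \<comment> \<open>Sorting is ascending; the negated heights, taken as integers, put the tallest
    columns first.\<close>
  define xs where "xs = sort_key (\<lambda>d. - int (h d)) xs\<^sub>0"
  have xs: "set xs = c ` V" "distinct xs" "sorted (map (\<lambda>d. - int (h d)) xs)"
    using xs0 by (simp_all add: xs_def)
  have "\<forall>d\<in>c ` V. \<exists>i. i < length xs \<and> xs ! i = d"
    using xs(1) by (metis in_set_conv_nth)
  then obtain pos where pos: "\<And>d. d \<in> c ` V \<Longrightarrow> pos d < length xs \<and> xs ! pos d = d"
    by metis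
  show ?thesis
  proof
    show "c x = c y \<longleftrightarrow> pos (c x) = pos (c y)" if "x \<in> V" "y \<in> V" for x y
      using that pos by (metis imageI)
    show "columns_initial V (\<lambda>x. pos (c x)) r"
      unfolding columns_initial_def
    proof (intro ballI allI impI)
      fix x i assume x: "x \<in> V" and i: "i < pos (c x)"
      have p: "pos (c x) < length xs" "xs ! pos (c x) = c x" using pos x by auto
      then have "xs ! i \<in> c ` V" using i xs(1) by (metis nth_mem order.strict_trans)
      have "- int (h (xs ! i)) \<le> - int (h (xs ! pos (c x)))"
        using sorted_nth_mono[OF xs(3), of i "pos (c x)"] i p(1) by simp
      then have "h (c x) \<le> h (xs ! i)" using p by simp
      moreover have "r x < h (c x)" using h x by (auto simp: I_def)
      ultimately have "r x \<in> I (xs ! i)" using h by simp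
      then obtain y where y: "y \<in> V" "c y = xs ! i" "r y = r x" by (auto simp: I_def)
      have "pos (xs ! i) = i"
        using pos[OF \<open>xs ! i \<in> c ` V\<close>] xs(2) i p(1) by (metis nth_eq_iff_index_eq order.strict_trans)
      then show "\<exists>y\<in>V. r y = r x \<and> pos (c y) = i" using y by auto
    qed
  qed
qed

text \<open>\<open>B\<close> is a matching, so it is no larger than \<open>X\<close> or
  \<open>Y\<close>. If the rows of \<open>X\<close> are all rows of \<open>Y\<close>, each vertex of
  \<open>X\<close> has a partner in its own row, which gives at least \<open>card X\<close> pairs on
  the right; the other case is symmetric.\<close>

lemma card_le_card_equal_rows:
  assumes fin: "finite X" "finite Y" and B: "B \<subseteq> X \<times> Y" and inj: "inj_on fst B" "inj_on snd B"
    and nested: "r\<^sub>1 ` X \<subseteq> r\<^sub>2 ` Y \<or> r\<^sub>2 ` Y \<subseteq> r\<^sub>1 ` X"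
  shows "card B \<le> card {(x, y). x \<in> X \<and> y \<in> Y \<and> r\<^sub>1 x = r\<^sub>2 y}"
proof -
  let ?D = "{(x, y). x \<in> X \<and> y \<in> Y \<and> r\<^sub>1 x = r\<^sub>2 y}"
  have "?D \<subseteq> X \<times> Y" by auto
  then have finD: "finite ?D" using fin by (meson finite_SigmaI finite_subset)
  from nested show ?thesis
  proof
    assume "r\<^sub>1 ` X \<subseteq> r\<^sub>2 ` Y"
    then have "X \<subseteq> fst ` ?D" by (force simp: image_iff)
    moreover have "fst ` B \<subseteq> X" using B by auto
    ultimately have "card (fst ` B) \<le> card (fst ` ?D)" using finD by (intro card_mono) auto
    also have "\<dots> \<le> card ?D" by (rule card_image_le[OF finD])
    finally show ?thesis by (simp add: card_image[OF inj(1)])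
  next
    assume "r\<^sub>2 ` Y \<subseteq> r\<^sub>1 ` X"
    then have "Y \<subseteq> snd ` ?D" by (force simp: image_iff)
    moreover have "snd ` B \<subseteq> Y" using B by auto
    ultimately have "card (snd ` B) \<le> card (snd ` ?D)" using finD by (intro card_mono) auto
    also have "\<dots> \<le> card ?D" by (rule card_image_le[OF finD])
    finally show ?thesis by (simp add: card_image[OF inj(2)])
  qed
qed

lemma card_eq_sum_fibres:
  assumes "finite B" "finite T" "f ` B \<subseteq> T"
  shows "card B = (\<Sum>t\<in>T. card {b \<in> B. f b = t})"
  using sum.group[OF assms, of "\<lambda>_. 1::nat"] by simp

text \<open>Two columns induce a matching of strong edges, because a strong neighbourhood is a clique
  and a column is independent.  As columns are initial segments, the shorter of the two columns
  meets only rows that the longer one meets as well.\<close>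

lemma card_cross_edges_le:
  fixes c\<^sub>1 :: "'a \<Rightarrow> 'b" and c\<^sub>2 :: "'a \<Rightarrow> 'c"
  assumes fin: "finite V\<^sub>1" "finite V\<^sub>2" and S: "stc_set E S"
    and init: "columns_initial V\<^sub>1 r\<^sub>1 c\<^sub>1" "columns_initial V\<^sub>2 r\<^sub>2 c\<^sub>2"
    and ind: "\<And>x y. x \<in> V\<^sub>1 \<Longrightarrow> y \<in> V\<^sub>1 \<Longrightarrow> x \<noteq> y \<Longrightarrow> c\<^sub>1 x = c\<^sub>1 y \<Longrightarrow> {x, y} \<notin> E"
      "\<And>x y. x \<in> V\<^sub>2 \<Longrightarrow> y \<in> V\<^sub>2 \<Longrightarrow> x \<noteq> y \<Longrightarrow> c\<^sub>2 x = c\<^sub>2 y \<Longrightarrow> {x, y} \<notin> E"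
  shows "card {(x, y). x \<in> V\<^sub>1 \<and> y \<in> V\<^sub>2 \<and> {x, y} \<in> S}
    \<le> card {(x, y). x \<in> V\<^sub>1 \<and> y \<in> V\<^sub>2 \<and> r\<^sub>1 x = r\<^sub>2 y}" (is "card ?B \<le> card ?D")
proof -
  let ?c = "\<lambda>(x, y). (c\<^sub>1 x, c\<^sub>2 y)"
  let ?T = "c\<^sub>1 ` V\<^sub>1 \<times> c\<^sub>2 ` V\<^sub>2"
  have BD: "?B \<subseteq> V\<^sub>1 \<times> V\<^sub>2" "?D \<subseteq> V\<^sub>1 \<times> V\<^sub>2" by auto
  note finBD = BD[THEN finite_subset, OF finite_cartesian_product[OF fin]]
  \<comment> \<open>Both sets are divided by the pair of columns containing the end points and
    compared block by block.\<close>
  have "card {p \<in> ?B. ?c p = t} \<le> card {p \<in> ?D. ?c p = t}" for t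
  proof -
    obtain a b where t: "t = (a, b)" by (cases t)
    let ?X = "{x \<in> V\<^sub>1. c\<^sub>1 x = a}" and ?Y = "{y \<in> V\<^sub>2. c\<^sub>2 y = b}"
    let ?B' = "{p \<in> ?B. ?c p = t}"
    have B': "(x, y) \<in> ?B' \<longleftrightarrow> x \<in> V\<^sub>1 \<and> y \<in> V\<^sub>2 \<and> {x, y} \<in> S \<and> c\<^sub>1 x = a \<and> c\<^sub>2 y = b" for x y
      unfolding t by simp
    have "inj_on fst ?B'"
    proof (rule inj_onI)
      fix p q assume "p \<in> ?B'" "q \<in> ?B'" "fst p = fst q"
      moreover obtain x y where p: "p = (x, y)" by (cases p)
      moreover obtain x' y' where q: "q = (x', y')" by (cases q)
      ultimately have *: "(x, y) \<in> ?B'" "(x, y') \<in> ?B'" "x' = x" by simp_all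
      then have "{y, x} \<in> S" "{x, y'} \<in> S" "y \<in> V\<^sub>2" "y' \<in> V\<^sub>2" "c\<^sub>2 y = c\<^sub>2 y'"
        unfolding B' by (simp_all add: insert_commute)
      then have "y = y'" using stc_setD[OF S] ind(2) by metis
      then show "p = q" using p q *(3) by simp
    qed
    moreover have "inj_on snd ?B'"
    proof (rule inj_onI)
      fix p q assume "p \<in> ?B'" "q \<in> ?B'" "snd p = snd q"
      moreover obtain x y where p: "p = (x, y)" by (cases p)
      moreover obtain x' y' where q: "q = (x', y')" by (cases q)
      ultimately have *: "(x, y) \<in> ?B'" "(x', y) \<in> ?B'" "y' = y" by simp_all
      then have "{x, y} \<in> S" "{y, x'} \<in> S" "x \<in> V\<^sub>1" "x' \<in> V\<^sub>1" "c\<^sub>1 x = c\<^sub>1 x'"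
        unfolding B' by (simp_all add: insert_commute)
      then have "x = x'" using stc_setD[OF S] ind(1) by metis
      then show "p = q" using p q *(3) by simp
    qed
    moreover have "r\<^sub>1 ` ?X \<subseteq> r\<^sub>2 ` ?Y \<or> r\<^sub>2 ` ?Y \<subseteq> r\<^sub>1 ` ?X"
    proof (rule disjCI, rule subsetI)
      fix i assume i: "i \<in> r\<^sub>1 ` ?X" and "\<not> r\<^sub>2 ` ?Y \<subseteq> r\<^sub>1 ` ?X"
      then obtain y where y: "y \<in> V\<^sub>2" "c\<^sub>2 y = b" "r\<^sub>2 y \<notin> r\<^sub>1 ` ?X" by auto
      from i obtain x where x: "x \<in> V\<^sub>1" "c\<^sub>1 x = a" "r\<^sub>1 x = i" by auto
      have "\<not> r\<^sub>2 y < r\<^sub>1 x"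
      proof
        assume "r\<^sub>2 y < r\<^sub>1 x"
        then obtain x' where "x' \<in> V\<^sub>1" "c\<^sub>1 x' = a" "r\<^sub>1 x' = r\<^sub>2 y"
          using columns_initialE[OF init(1) x(1)] x(2) by metis
        then show False using y(3) by force
      qed
      moreover have "r\<^sub>2 y \<noteq> r\<^sub>1 x" using x y by force
      ultimately have "i < r\<^sub>2 y" using x by simp
      then obtain y' where "y' \<in> V\<^sub>2" "c\<^sub>2 y' = b" "r\<^sub>2 y' = i"
        using columns_initialE[OF init(2) y(1)] y(2) by metis
      then show "i \<in> r\<^sub>2 ` ?Y" by force
    qed
    moreover have "?B' \<subseteq> ?X \<times> ?Y" by (auto simp: t)
    ultimately have "card ?B' \<le> card {(x, y). x \<in> ?X \<and> y \<in> ?Y \<and> r\<^sub>1 x = r\<^sub>2 y}"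
      using fin by (intro card_le_card_equal_rows) auto
    also have "{(x, y). x \<in> ?X \<and> y \<in> ?Y \<and> r\<^sub>1 x = r\<^sub>2 y} = {p \<in> ?D. ?c p = t}"
      by (auto simp: t)
    finally show ?thesis .
  qed
  then have "(\<Sum>t\<in>?T. card {p \<in> ?B. ?c p = t}) \<le> (\<Sum>t\<in>?T. card {p \<in> ?D. ?c p = t})"
    by (rule sum_mono)
  moreover have "finite ?T" using fin by simp
  ultimately show ?thesis
    using card_eq_sum_fibres[OF finBD(1) \<open>finite ?T\<close>, of ?c]
      card_eq_sum_fibres[OF finBD(2) \<open>finite ?T\<close>, of ?c] by fastforce
qed

text \<open>A join merges rows of equal number into larger cliques and keeps the columns apart; a
  disjoint union merges columns and keeps the rows apart. The shape of the diagram is carried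
  through the induction because the bound on the cross edges of a join rests on it.\<close>

lemma P4_free_layout:
  assumes "finite V" "P4_free_on V E"
  shows "\<exists>(r :: 'a \<Rightarrow> nat) (c :: 'a \<Rightarrow> nat). columns_initial V r c \<and> cliques_and_independent_sets E V r c \<and>
    (\<forall>S. stc_set E S \<longrightarrow> S \<subseteq> [V]\<^bsup>2\<^esup> \<longrightarrow> card S \<le> card (class_pairs V r))"
  using assms
proof (induction V rule: finite_psubset_induct)
  case (psubset V)
  show ?case
  proof (cases "card V \<ge> 2")
    case False
    then have "[V]\<^bsup>2\<^esup> = {}" using psubset.hyps(1) by (intro nsets_eq_empty) auto
    moreover have "x = y" if "x \<in> V" "y \<in> V" for x y
      using False that psubset.hyps(1) card_le_Suc0_iff_eq[of V] by auto
    ultimately show ?thesis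
      by (intro exI[of _ "\<lambda>_. 0"]) (auto simp: columns_initial_def cliques_and_independent_sets_def)
  next
    case True
    obtain A B where V: "V = A \<union> B" and disj: "A \<inter> B = {}" and ne: "A \<noteq> {}" "B \<noteq> {}"
      and split: "(\<forall>x\<in>A. \<forall>y\<in>B. {x, y} \<in> E) \<or> (\<forall>x\<in>A. \<forall>y\<in>B. {x, y} \<notin> E)"
      using P4_free_split[OF psubset.hyps(1) True psubset.prems] by blast
    have fin: "finite A" "finite B" using V psubset.hyps(1) by auto
    have sub: "A \<subset> V" "B \<subset> V" using V disj ne by auto
    obtain r\<^sub>1 c\<^sub>1 :: "'a \<Rightarrow> nat" where A: "columns_initial A r\<^sub>1 c\<^sub>1" "cliques_and_independent_sets E A r\<^sub>1 c\<^sub>1"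
      and bA: "\<And>S. stc_set E S \<Longrightarrow> S \<subseteq> [A]\<^bsup>2\<^esup> \<Longrightarrow> card S \<le> card (class_pairs A r\<^sub>1)"
      using psubset.IH[OF sub(1)] P4_free_on_subset[OF psubset.prems, of A] sub(1) by blast
    obtain r\<^sub>2 c\<^sub>2 :: "'a \<Rightarrow> nat" where B: "columns_initial B r\<^sub>2 c\<^sub>2" "cliques_and_independent_sets E B r\<^sub>2 c\<^sub>2"
      and bB: "\<And>S. stc_set E S \<Longrightarrow> S \<subseteq> [B]\<^bsup>2\<^esup> \<Longrightarrow> card S \<le> card (class_pairs B r\<^sub>2)"
      using psubset.IH[OF sub(2)] P4_free_on_subset[OF psubset.prems, of B] sub(2) by blast
    have inB: "x \<notin> A" if "x \<in> B" for x using that disj by blast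
    \<comment> \<open>\<open>stack\<close> reuses the numbers of both parts, so that classes with
      equal numbers merge. \<open>apart\<close> gives even numbers to \<open>A\<close> and odd ones
      to \<open>B\<close>, so that no class of one part merges with a class of the other.\<close>
    define stack where "stack f g x = (if x \<in> A then f x else g x)" for f g :: "'a \<Rightarrow> nat" and x
    define apart where "apart f g = stack (\<lambda>x. 2 * f x) (\<lambda>x. Suc (2 * g x))" for f g
    have stack: "x \<in> A \<Longrightarrow> stack f g x = f x" "x \<in> B \<Longrightarrow> stack f g x = g x" for f g x
      using inB by (auto simp: stack_def)
    have apart: "x \<in> A \<Longrightarrow> apart f g x = 2 * f x" "x \<in> B \<Longrightarrow> apart f g x = Suc (2 * g x)" for f g x
      by (simp_all add: apart_def stack)
    have [simp]: "2 * i \<noteq> Suc (2 * j)" "Suc (2 * j) \<noteq> 2 * i" for i j :: nat by presburger+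
    \<comment> \<open>Stated for arbitrary numberings: the join uses it for rows and columns as they
      are, the disjoint union with the two exchanged.\<close>
    have init: "columns_initial V (stack r r') (apart c c')"
      if A': "columns_initial A r c" and B': "columns_initial B r' c'" for r r' c c'
      unfolding columns_initial_def
    proof (intro ballI allI impI)
      fix x i assume x: "x \<in> V" and i: "i < stack r r' x"
      show "\<exists>y\<in>V. apart c c' y = apart c c' x \<and> stack r r' y = i"
      proof (cases "x \<in> A")
        case True
        then have "i < r x" using i by (simp add: stack)
        then obtain y where "y \<in> A" "c y = c x" "r y = i"
          using columns_initialE[OF A' True] by metis
        then show ?thesis using True V by (intro bexI[of _ y]) (simp_all add: stack apart)
      next
        case False
        then have "x \<in> B" using x V by blast
        then have "i < r' x" using i by (simp add: stack)
        then obtain y where "y \<in> B" "c' y = c' x" "r' y = i"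
          using columns_initialE[OF B' \<open>x \<in> B\<close>] by metis
        then show ?thesis using \<open>x \<in> B\<close> V by (intro bexI[of _ y]) (simp_all add: stack apart)
      qed
    qed
    from split show ?thesis
    proof
      assume join: "\<forall>x\<in>A. \<forall>y\<in>B. {x, y} \<in> E"
      let ?r = "stack r\<^sub>1 r\<^sub>2" and ?c = "apart c\<^sub>1 c\<^sub>2"
      have "cliques_and_independent_sets E V ?r ?c"
        unfolding cliques_and_independent_sets_def
      proof (intro ballI impI)
        fix x y assume xy: "x \<in> V" "y \<in> V" "x \<noteq> y"
        then consider "x \<in> A" "y \<in> A" | "x \<in> B" "y \<in> B" | "x \<in> A" "y \<in> B" | "y \<in> A" "x \<in> B"
          unfolding V by blast
        then show "(?r x = ?r y \<longrightarrow> {x, y} \<in> E) \<and> (?c x = ?c y \<longrightarrow> {x, y} \<notin> E)"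
        proof cases
          case 4
          then have "{x, y} \<in> E" using join by (metis insert_commute)
          then show ?thesis using 4 by (simp add: apart)
        qed (use A(2) B(2) join xy(3) in \<open>simp_all add: stack apart cliques_and_independent_sets_def\<close>)
      qed
      moreover have "card S \<le> card (class_pairs V ?r)" if S: "stc_set E S" "S \<subseteq> [V]\<^bsup>2\<^esup>" for S
      proof -
        have "card {(x, y). x \<in> A \<and> y \<in> B \<and> {x, y} \<in> S}
            \<le> card {(x, y). x \<in> A \<and> y \<in> B \<and> r\<^sub>1 x = r\<^sub>2 y}"
          using A(2) B(2) unfolding cliques_and_independent_sets_def
          by (intro card_cross_edges_le[OF fin S(1) A(1) B(1)]) auto
        also have "{(x, y). x \<in> A \<and> y \<in> B \<and> r\<^sub>1 x = r\<^sub>2 y} = {(x, y). x \<in> A \<and> y \<in> B \<and> ?r x = ?r y}"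
          by (auto simp: stack)
        finally show ?thesis
          unfolding V using S(2)
          by (intro card_le_card_class_pairs_Un[OF fin disj bA bB _ _ S(1)]) (auto simp: stack V)
      qed
      ultimately show ?thesis using init[OF A(1) B(1)] by blast
    next
      assume no_edge: "\<forall>x\<in>A. \<forall>y\<in>B. {x, y} \<notin> E"
      \<comment> \<open>Both diagrams are transposed, their columns are stacked with the rows kept
        apart, and the result is transposed back.\<close>
      obtain c\<^sub>1' :: "'a \<Rightarrow> nat" where c1: "\<And>x y. x \<in> A \<Longrightarrow> y \<in> A \<Longrightarrow> c\<^sub>1 x = c\<^sub>1 y \<longleftrightarrow> c\<^sub>1' x = c\<^sub>1' y"
        "columns_initial A c\<^sub>1' r\<^sub>1"
        using columns_initial_transpose[OF fin(1) A(1)] by blast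
      obtain c\<^sub>2' :: "'a \<Rightarrow> nat" where c2: "\<And>x y. x \<in> B \<Longrightarrow> y \<in> B \<Longrightarrow> c\<^sub>2 x = c\<^sub>2 y \<longleftrightarrow> c\<^sub>2' x = c\<^sub>2' y"
        "columns_initial B c\<^sub>2' r\<^sub>2"
        using columns_initial_transpose[OF fin(2) B(1)] by blast
      let ?c = "stack c\<^sub>1' c\<^sub>2'"
      obtain r :: "'a \<Rightarrow> nat" where r: "\<And>x y. x \<in> V \<Longrightarrow> y \<in> V \<Longrightarrow> apart r\<^sub>1 r\<^sub>2 x = apart r\<^sub>1 r\<^sub>2 y \<longleftrightarrow> r x = r y"
        and init_r: "columns_initial V r ?c"
        using columns_initial_transpose[OF psubset.hyps(1) init[OF c1(2) c2(2)]] by blast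
      have rA: "r x = r y \<longleftrightarrow> r\<^sub>1 x = r\<^sub>1 y" if "x \<in> A" "y \<in> A" for x y
        using r[of x y] that V by (simp add: apart)
      have rB: "r x = r y \<longleftrightarrow> r\<^sub>2 x = r\<^sub>2 y" if "x \<in> B" "y \<in> B" for x y
        using r[of x y] that V by (simp add: apart)
      have rAB: "r x \<noteq> r y" "r y \<noteq> r x" if "x \<in> A" "y \<in> B" for x y
        using r[of x y] r[of y x] that V by (auto simp: apart)
      have "cliques_and_independent_sets E V r ?c"
        unfolding cliques_and_independent_sets_def
      proof (intro ballI impI)
        fix x y assume xy: "x \<in> V" "y \<in> V" "x \<noteq> y"
        then consider "x \<in> A" "y \<in> A" | "x \<in> B" "y \<in> B" | "x \<in> A" "y \<in> B" | "y \<in> A" "x \<in> B"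
          unfolding V by blast
        then show "(r x = r y \<longrightarrow> {x, y} \<in> E) \<and> (?c x = ?c y \<longrightarrow> {x, y} \<notin> E)"
        proof cases
          case 4
          then have "{x, y} \<notin> E" using no_edge by (metis insert_commute)
          then show ?thesis using 4 by (simp add: rAB)
        qed (use A(2) B(2) no_edge xy(3) in
            \<open>simp_all add: stack rA rB rAB cliques_and_independent_sets_def flip: c1(1) c2(1)\<close>)
      qed
      moreover have "card S \<le> card (class_pairs V r)" if S: "stc_set E S" "S \<subseteq> [V]\<^bsup>2\<^esup>" for S
      proof -
        have "{(x, y). x \<in> A \<and> y \<in> B \<and> {x, y} \<in> S} = {}"
          using S(1) no_edge unfolding stc_set_def by auto
        then have "card {(x, y). x \<in> A \<and> y \<in> B \<and> {x, y} \<in> S}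
            \<le> card {(x, y). x \<in> A \<and> y \<in> B \<and> r x = r y}"
          by (simp only: card.empty)
        then show ?thesis
          unfolding V using S(2)
          by (intro card_le_card_class_pairs_Un[OF fin disj bA bB _ _ S(1)]) (auto simp: rA rB V)
      qed
      ultimately show ?thesis using init_r by blast
    qed
  qed
qed

lemma P4_free_cluster_solvable:
  assumes "finite V" "P4_free_on V E"
  shows "cluster_solvable V E"
proof -
  obtain r c :: "'a \<Rightarrow> nat" where "cliques_and_independent_sets E V r c"
    and "\<And>S. stc_set E S \<Longrightarrow> S \<subseteq> [V]\<^bsup>2\<^esup> \<Longrightarrow> card S \<le> card (class_pairs V r)"
    using P4_free_layout[OF assms] by blast
  then show ?thesis
    by (intro cluster_solvableI[OF assms(1), of r])
      (auto simp: cliques_and_independent_sets_def class_pairs_def)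
qed

section \<open>Induced copies of small graphs\<close>

lemma simple_graph_edgeD:
  assumes "simple_graph G" "{x, y} \<in> edges G"
  shows "x \<in> verts G" "y \<in> verts G" "x \<noteq> y"
  using subsetD[of "edges G" "[verts G]\<^bsup>2\<^esup>", OF _ assms(2)] assms(1) by (simp_all add: simple_graph_def)

text \<open>The inverse of an isomorphism onto \<open>H\<close> is an injection of its vertices that
  preserves and reflects adjacency. In simple graphs every edge is a pair, so testing pairs of
  vertices determines the edge sets.\<close>

lemma free_graphs_iff:
  assumes H: "simple_graph H"
  shows "G \<in> free_graphs H \<longleftrightarrow> simple_graph G \<and>
    \<not> (\<exists>g. inj_on g (verts H) \<and> g ` verts H \<subseteq> verts G \<and>
      (\<forall>i\<in>verts H. \<forall>j\<in>verts H. {g i, g j} \<in> edges G \<longleftrightarrow> {i, j} \<in> edges H))"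
proof -
  have "(\<exists>U \<subseteq> verts G. graph_iso (induced_subgraph G U) H) \<longleftrightarrow>
    (\<exists>g. inj_on g (verts H) \<and> g ` verts H \<subseteq> verts G \<and>
      (\<forall>i\<in>verts H. \<forall>j\<in>verts H. {g i, g j} \<in> edges G \<longleftrightarrow> {i, j} \<in> edges H))"
    (is "?L \<longleftrightarrow> ?R") if G: "simple_graph G"
  proof
    assume ?L
    then obtain U f where U: "U \<subseteq> verts G" and f: "bij_betw f U (verts H)"
      and E: "edges H = (`) f ` {e \<in> edges G. e \<subseteq> U}"
      by (auto simp: graph_iso_def induced_subgraph_def)
    define g where "g = inv_into U f"
    have g: "bij_betw g (verts H) U" using f by (simp add: g_def bij_betw_inv_into)
    have fg: "f (g i) = i" if "i \<in> verts H" for i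
      using f that by (simp add: g_def bij_betw_inv_into_right)
    have gf: "g (f u) = u" if "u \<in> U" for u
      using f that by (simp add: g_def bij_betw_inv_into_left)
    have gU: "g i \<in> U" if "i \<in> verts H" for i using g that by (auto simp: bij_betw_def)
    have "{g i, g j} \<in> edges G \<longleftrightarrow> {i, j} \<in> edges H" if ij: "i \<in> verts H" "j \<in> verts H" for i j
    proof
      assume "{g i, g j} \<in> edges G"
      then have "f ` {g i, g j} \<in> edges H" unfolding E using gU ij by (intro imageI) auto
      then show "{i, j} \<in> edges H" using ij by (simp add: fg)
    next
      assume "{i, j} \<in> edges H"
      then obtain e where e: "e \<in> edges G" "e \<subseteq> U" "{i, j} = f ` e" unfolding E by auto
      have "{g i, g j} = g ` f ` e" using e(3) by (metis image_empty image_insert)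
      also have "\<dots> = e" using gf e(2) by (force simp: image_image)
      finally show "{g i, g j} \<in> edges G" using e(1) by simp
    qed
    moreover have "inj_on g (verts H)" "g ` verts H \<subseteq> verts G"
      using g U unfolding bij_betw_def by auto
    ultimately show ?R by (intro exI[of _ g] conjI ballI)
  next
    assume ?R
    then obtain g where inj: "inj_on g (verts H)" and sub: "g ` verts H \<subseteq> verts G"
      and "\<forall>i\<in>verts H. \<forall>j\<in>verts H. {g i, g j} \<in> edges G \<longleftrightarrow> {i, j} \<in> edges H"
      by (elim exE conjE)
    then have E: "{g i, g j} \<in> edges G \<longleftrightarrow> {i, j} \<in> edges H" if "i \<in> verts H" "j \<in> verts H" for i j
      using that by simp
    define f where "f = inv_into (verts H) g"
    have f: "bij_betw f (g ` verts H) (verts H)"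
      using inj by (simp add: f_def bij_betw_inv_into inj_on_imp_bij_betw)
    have fg: "f (g i) = i" if "i \<in> verts H" for i
      using inj that by (simp add: f_def)
    have "edges H = (`) f ` {e \<in> edges G. e \<subseteq> g ` verts H}" (is "_ = ?F")
    proof (rule nsets_2_eqI[where V = "verts H"])
      show EH: "edges H \<subseteq> [verts H]\<^bsup>2\<^esup>" using H by (simp add: simple_graph_def)
      show F: "?F \<subseteq> [verts H]\<^bsup>2\<^esup>"
      proof clarify
        fix e assume e: "e \<in> edges G" "e \<subseteq> g ` verts H"
        then obtain x y where "e = {x, y}" "x \<noteq> y"
          using G unfolding simple_graph_def by (meson nsets2_E subsetD)
        then show "f ` e \<in> [verts H]\<^bsup>2\<^esup>" using e(2) by (auto simp: fg)
      qed
      fix i j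
      show "{i, j} \<in> edges H \<longleftrightarrow> {i, j} \<in> ?F"
      proof
        assume ij: "{i, j} \<in> edges H"
        then have "i \<in> verts H" "j \<in> verts H" using simple_graph_edgeD[OF H ij] by auto
        then show "{i, j} \<in> ?F"
          using ij by (intro image_eqI[of _ _ "{g i, g j}"]) (simp_all add: fg E)
      next
        assume "{i, j} \<in> ?F"
        then obtain e where e: "e \<in> edges G" "e \<subseteq> g ` verts H" "{i, j} = f ` e" by auto
        then obtain x y where xy: "e = {x, y}"
          using G unfolding simple_graph_def by (meson nsets2_E subsetD)
        then obtain i' j' where "i' \<in> verts H" "j' \<in> verts H" "x = g i'" "y = g j'" using e(2) by auto
        then show "{i, j} \<in> edges H" using e(1,3) xy by (simp add: fg E)
      qed
    qed
    then have "graph_iso (induced_subgraph G (g ` verts H)) H"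
      using f by (auto simp: graph_iso_def induced_subgraph_def)
    then show ?L using sub by blast
  qed
  then show ?thesis unfolding free_graphs_def by blast
qed

lemma free_graphsD:
  assumes "G \<in> free_graphs H" "simple_graph H" "inj_on g (verts H)" "g ` verts H \<subseteq> verts G"
    "\<And>i j. i \<in> verts H \<Longrightarrow> j \<in> verts H \<Longrightarrow> {g i, g j} \<in> edges G \<longleftrightarrow> {i, j} \<in> edges H"
  shows False
  using assms free_graphs_iff[OF assms(2), of G] by blast

lemma lessThan_small:
  "{..<2} = {0, 1 :: nat}" "{..<3} = {0, 1, 2 :: nat}" "{..<4} = {0, 1, 2, 3 :: nat}"
  by (auto simp: less_Suc_eq numeral_eq_Suc)

lemma edges_path_graph: "edges (path_graph (Suc n)) = (\<lambda>i. {i, Suc i}) ` {..<n}"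
  by (simp add: path_graph_def setcompr_eq_image lessThan_def)

lemma path_graph_3: "path_graph 3 = Graph {0, 1, 2} {{0, 1}, {1, 2}}"
  using edges_path_graph[of 2] by (intro graph.expand) (simp add: path_graph_def lessThan_small flip: numeral_2_eq_2)

lemma path_graph_4: "path_graph 4 = Graph {0, 1, 2, 3} {{0, 1}, {1, 2}, {2, 3}}"
  using edges_path_graph[of 3] by (intro graph.expand) (simp add: path_graph_def lessThan_small flip: numeral_2_eq_2)

lemma complete_graph_3: "complete_graph 3 = Graph {0, 1, 2} {{0, 1}, {0, 2}, {1, 2}}"
  by (simp add: complete_graph_def lessThan_small nsets_2_eq insert_Diff_if insert_commute)

lemma edgeless_graph_3: "edgeless_graph 3 = Graph {0, 1, 2} {}"
  by (simp add: edgeless_graph_def lessThan_small)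

lemma edgeless_graph_4: "edgeless_graph 4 = Graph {0, 1, 2, 3} {}"
  by (simp add: edgeless_graph_def lessThan_small)

lemmas small_graph_defs = path_graph_3 path_graph_4 complete_graph_3 edgeless_graph_3 edgeless_graph_4
  C4_def K2_plus_K1_def two_K2_def claw_def paw_def diamond_def co_claw_def co_paw_def co_diamond_def

lemma simple_small_graphs:
  "simple_graph (path_graph 3)" "simple_graph (path_graph 4)" "simple_graph (complete_graph 3)"
  "simple_graph (edgeless_graph 3)" "simple_graph (edgeless_graph 4)" "simple_graph C4"
  "simple_graph K2_plus_K1" "simple_graph two_K2" "simple_graph claw" "simple_graph paw"
  "simple_graph diamond" "simple_graph co_claw" "simple_graph co_paw" "simple_graph co_diamond"
  by (simp_all add: simple_graph_def small_graph_defs)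

lemma simple_complete_graph: "simple_graph (complete_graph n)"
  by (simp add: simple_graph_def complete_graph_def)

lemma free_graphs_imp_simple: "G \<in> free_graphs H \<Longrightarrow> simple_graph G"
  by (simp add: free_graphs_def)

text \<open>Adjacency is symmetric and neither graph has loops, so three unordered pairs decide all
  nine ordered ones.\<close>

lemma free_graphs_3D:
  assumes G: "G \<in> free_graphs H" and H: "simple_graph H" "verts H = {0, 1, 2 :: nat}"
    and abc: "a \<in> verts G" "b \<in> verts G" "c \<in> verts G" "distinct [a, b, c]"
    and E: "{a, b} \<in> edges G \<longleftrightarrow> {0, 1} \<in> edges H" "{a, c} \<in> edges G \<longleftrightarrow> {0, 2} \<in> edges H"
      "{b, c} \<in> edges G \<longleftrightarrow> {1, 2} \<in> edges H"
  shows False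
proof -
  have nl: "{x} \<notin> edges G" "{i} \<notin> edges H" for x i
    using simple_graph_edgeD(3)[OF free_graphs_imp_simple[OF G], of x x]
      simple_graph_edgeD(3)[OF H(1), of i i] by auto
  \<comment> \<open>The default value \<open>a\<close> serves as the image of
    \<open>0\<close>.\<close>
  define g where "g = (\<lambda>_ :: nat. a)(1 := b, 2 := c)"
  have g: "g 0 = a" "g 1 = b" "g (Suc 0) = b" "g 2 = c" by (simp_all add: g_def)
  have *: "inj_on g (verts H)" "g ` verts H \<subseteq> verts G"
    using abc by (simp_all add: H(2) g eq_commute)
  have "\<forall>i\<in>verts H. \<forall>j\<in>verts H. {g i, g j} \<in> edges G \<longleftrightarrow> {i, j} \<in> edges H"
    using E unfolding H(2) by (simp add: g nl insert_commute)
  then show False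
    by (intro free_graphsD[OF G H(1) *]) simp
qed

lemma free_graphs_4D:
  assumes G: "G \<in> free_graphs H" and H: "simple_graph H" "verts H = {0, 1, 2, 3 :: nat}"
    and abc: "a \<in> verts G" "b \<in> verts G" "c \<in> verts G" "d \<in> verts G" "distinct [a, b, c, d]"
    and E: "{a, b} \<in> edges G \<longleftrightarrow> {0, 1} \<in> edges H" "{a, c} \<in> edges G \<longleftrightarrow> {0, 2} \<in> edges H"
      "{a, d} \<in> edges G \<longleftrightarrow> {0, 3} \<in> edges H" "{b, c} \<in> edges G \<longleftrightarrow> {1, 2} \<in> edges H"
      "{b, d} \<in> edges G \<longleftrightarrow> {1, 3} \<in> edges H" "{c, d} \<in> edges G \<longleftrightarrow> {2, 3} \<in> edges H"
  shows False
proof -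
  have nl: "{x} \<notin> edges G" "{i} \<notin> edges H" for x i
    using simple_graph_edgeD(3)[OF free_graphs_imp_simple[OF G], of x x]
      simple_graph_edgeD(3)[OF H(1), of i i] by auto
  define g where "g = (\<lambda>_ :: nat. a)(1 := b, 2 := c, 3 := d)"
  have g: "g 0 = a" "g 1 = b" "g (Suc 0) = b" "g 2 = c" "g 3 = d" by (simp_all add: g_def)
  have *: "inj_on g (verts H)" "g ` verts H \<subseteq> verts G"
    using abc by (simp_all add: H(2) g eq_commute)
  have "\<forall>i\<in>verts H. \<forall>j\<in>verts H. {g i, g j} \<in> edges G \<longleftrightarrow> {i, j} \<in> edges H"
    using E unfolding H(2) by (simp add: g nl insert_commute)
  then show False
    by (intro free_graphsD[OF G H(1) *]) simp
qed

section \<open>Classes on which the problems correspond\<close>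

text \<open>An induced path \<open>a b c d\<close> contains an induced \<open>P\<^sub>3\<close> on
  \<open>a, b, c\<close> and an induced \<open>K2_plus_K1\<close> on \<open>a, b, d\<close>, so
  excluding any of the three graphs excludes the path.\<close>

lemma correspond_on_P4_free:
  assumes H: "H \<in> {path_graph 3, K2_plus_K1, path_graph 4}"
  shows "correspond_on (free_graphs H)"
proof (rule correspond_onI)
  fix G :: "'a graph" assume G: "G \<in> free_graphs H"
  have "P4_free_on (verts G) (edges G)"
    unfolding P4_free_on_def
  proof (rule notI, elim bexE conjE)
    fix a b c d
    assume *: "a \<in> verts G" "b \<in> verts G" "c \<in> verts G" "d \<in> verts G" "distinct [a, b, c, d]"
      "{a, b} \<in> edges G" "{b, c} \<in> edges G" "{c, d} \<in> edges G"
      "{a, c} \<notin> edges G" "{a, d} \<notin> edges G" "{b, d} \<notin> edges G"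
    from H consider "H = path_graph 3" | "H = K2_plus_K1" | "H = path_graph 4" by blast
    then show False
    proof cases
      case 1
      show False
        by (rule free_graphs_3D[OF G, of a b c])
          (use * in \<open>simp_all add: 1 simple_graph_def small_graph_defs doubleton_eq_iff\<close>)
    next
      case 2
      show False
        by (rule free_graphs_3D[OF G, of a b d])
          (use * in \<open>simp_all add: 2 simple_graph_def small_graph_defs doubleton_eq_iff\<close>)
    next
      case 3
      show False
        by (rule free_graphs_4D[OF G, of a b c d])
          (use * in \<open>simp_all add: 3 simple_graph_def small_graph_defs doubleton_eq_iff\<close>)
    qed
  qed
  then show "simple_graph G \<and> cluster_solvable (verts G) (edges G)"
    using free_graphs_imp_simple[OF G] P4_free_cluster_solvable by (auto simp: simple_graph_def)
qed

text \<open>Non-adjacent common neighbours \<open>x, y\<close> of the ends of an edge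
  \<open>a b\<close> complete it to an induced diamond, and \<open>a, b, x\<close> is already a
  triangle.\<close>

lemma correspond_on_diamond_free:
  assumes H: "H \<in> {complete_graph 3, diamond}"
  shows "correspond_on (free_graphs H)"
proof (rule correspond_onI)
  fix G :: "'a graph" assume G: "G \<in> free_graphs H"
  note simple = free_graphs_imp_simple[OF G]
  have "cluster_solvable (verts G) (edges G)"
  proof (rule diamond_free_cluster_solvable)
    show "finite (verts G)" using simple by (simp add: simple_graph_def)
    fix a b x y
    assume *: "a \<in> verts G" "b \<in> verts G" "x \<in> verts G" "y \<in> verts G" "{a, b} \<in> edges G"
      "{a, x} \<in> edges G" "{a, y} \<in> edges G" "{b, x} \<in> edges G" "{b, y} \<in> edges G" "x \<noteq> y"
    have dist: "distinct [a, b, x, y]"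
      using *(5-9)[THEN simple_graph_edgeD(3)[OF simple]] *(10) by auto
    show "{x, y} \<in> edges G"
    proof (rule ccontr)
      assume xy: "{x, y} \<notin> edges G"
      from H consider "H = complete_graph 3" | "H = diamond" by blast
      then show False
      proof cases
        case 1
        show False
          by (rule free_graphs_3D[OF G, of a b x])
            (use * dist in \<open>simp_all add: 1 simple_graph_def small_graph_defs doubleton_eq_iff\<close>)
      next
        case 2
        show False
          by (rule free_graphs_4D[OF G, of a b x y])
            (use * dist xy in \<open>simp_all add: 2 simple_graph_def small_graph_defs doubleton_eq_iff\<close>)
      qed
    qed
  qed
  then show "simple_graph G \<and> cluster_solvable (verts G) (edges G)" using simple by simp
qed

text \<open>The set \<open>T\<close> of vertices on triangles is closed under adjacency, so the
  graph falls apart into \<open>T\<close>, which has no induced \<open>P\<^sub>4\<close>, and a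
  remainder without triangles. Each part is solved by its own method.\<close>

lemma correspond_on_paw_free: "correspond_on (free_graphs paw)"
proof (rule correspond_onI)
  fix G :: "'a graph" assume G: "G \<in> free_graphs paw"
  note simple = free_graphs_imp_simple[OF G]
  let ?E = "edges G"
  have fin: "finite (verts G)" using simple by (simp add: simple_graph_def)
  note edgeD = simple_graph_edgeD[OF simple]
  have swap: "{y, x} \<in> ?E" if "{x, y} \<in> ?E" for x y using that by (simp add: insert_commute)
  have paw: "{a, d} \<in> ?E \<or> {b, d} \<in> ?E"
    if *: "{a, b} \<in> ?E" "{a, c} \<in> ?E" "{b, c} \<in> ?E" "{c, d} \<in> ?E" "d \<noteq> a" "d \<noteq> b" for a b c d
  proof (rule ccontr)
    assume no: "\<not> ?thesis"
    have dist: "distinct [a, b, c, d]"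
      using *(1-4)[THEN edgeD(3)] *(5,6) by auto
    show False
      by (rule free_graphs_4D[OF G, of a b c d])
        (use * no dist edgeD(1)[OF *(1)] edgeD(2)[OF *(1)] edgeD(1)[OF *(4)] edgeD(2)[OF *(4)] in
          \<open>simp_all add: simple_graph_def small_graph_defs doubleton_eq_iff\<close>)
  qed
  define T where "T = {v \<in> verts G. \<exists>x y. {v, x} \<in> ?E \<and> {v, y} \<in> ?E \<and> {x, y} \<in> ?E}"
  \<comment> \<open>Either \<open>u\<close> lies on a triangle at \<open>v\<close>, or
    \<open>v u\<close> is attached to it and must not be the pendant edge of an induced paw.\<close>
  have triangle: "\<exists>x. {v, x} \<in> ?E \<and> {u, x} \<in> ?E" if vT: "v \<in> T" and vu: "{v, u} \<in> ?E" for v u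
  proof -
    obtain x y where xy: "{v, x} \<in> ?E" "{v, y} \<in> ?E" "{x, y} \<in> ?E" using vT by (auto simp: T_def)
    show ?thesis
      using paw[of x y v u] xy vu swap by metis
  qed
  have closed: "u \<in> T" if vT: "v \<in> T" and vu: "{v, u} \<in> ?E" for v u
  proof -
    obtain x where "{v, x} \<in> ?E" "{u, x} \<in> ?E" using triangle[OF vT vu] by blast
    then show ?thesis using swap[OF vu] edgeD(2)[OF vu] unfolding T_def by blast
  qed
  have "P4_free_on T ?E"
    unfolding P4_free_on_def
  proof (rule notI, elim bexE conjE)
    fix a b c d
    assume *: "a \<in> T" "distinct [a, b, c, d]" "{a, b} \<in> ?E" "{b, c} \<in> ?E" "{c, d} \<in> ?E"
      "{a, c} \<notin> ?E" "{a, d} \<notin> ?E" "{b, d} \<notin> ?E"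
    \<comment> \<open>The common neighbour \<open>x\<close> of \<open>a\<close> and \<open>b\<close>
      is pushed along the path: it is adjacent to \<open>c\<close>, then to \<open>d\<close>, and
      finally \<open>a, b, x\<close> with \<open>d\<close> attached to \<open>x\<close> is an
      induced paw.\<close>
    obtain x where x: "{a, x} \<in> ?E" "{b, x} \<in> ?E" using triangle[OF *(1,3)] by blast
    have "c \<noteq> x" "d \<noteq> x" using x *(6,7) by auto
    have ne: "c \<noteq> a" "d \<noteq> a" "d \<noteq> b" using *(2) by auto
    have cx: "{x, c} \<in> ?E"
      using paw[OF x(1) *(3) swap[OF x(2)] *(4) ne(1) \<open>c \<noteq> x\<close>] *(6) by blast
    have dx: "{x, d} \<in> ?E"
      using paw[OF x(2) *(4) cx *(5) ne(3) \<open>d \<noteq> x\<close>] *(8) by blast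
    show False
      using paw[OF *(3) x dx ne(2,3)] *(7,8) by blast
  qed
  moreover have "finite T" using fin by (simp add: T_def)
  ultimately have "cluster_solvable T ?E" by (intro P4_free_cluster_solvable)
  moreover have "cluster_solvable (verts G - T) ?E"
  proof (rule diamond_free_cluster_solvable)
    show "finite (verts G - T)" using fin by simp
    fix a b x assume "a \<in> verts G - T" "{a, b} \<in> ?E" "{a, x} \<in> ?E" "{b, x} \<in> ?E"
    then have False unfolding T_def by blast
    then show "{x, y} \<in> ?E" for y ..
  qed
  moreover have "{v, u} \<notin> ?E" if "v \<in> T" "u \<in> verts G - T" for v u
    using closed[OF that(1), of u] that(2) by blast
  ultimately have "cluster_solvable (T \<union> (verts G - T)) ?E"
    using fin \<open>finite T\<close> by (intro cluster_solvable_Un) simp_all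
  moreover have "T \<union> (verts G - T) = verts G" by (auto simp: T_def)
  ultimately show "simple_graph G \<and> cluster_solvable (verts G) ?E" using simple by simp
qed

section \<open>Upper bounds for cluster labelings\<close>

text \<open>Summing the bound over the disjoint clusters gives at most \<open>m * card K\<close>
  edges. Equality would make every cluster tight and the clusters would cover \<open>K\<close>; then
  \<open>3\<close> would divide every summand, hence \<open>card K\<close>.\<close>

lemma cluster_labeling_card_less:
  assumes G: "simple_graph G" and cl: "cluster_labeling G S W" and K: "finite K" "\<not> 3 dvd card K" "0 < m"
    and bound: "\<And>C. C \<subseteq> verts G \<Longrightarrow> \<forall>x\<in>C. \<forall>y\<in>C. x \<noteq> y \<longrightarrow> {x, y} \<in> edges G \<Longrightarrow>
      card C choose 2 \<le> m * card (C \<inter> K) \<and>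
      (card C choose 2 = m * card (C \<inter> K) \<longrightarrow> 3 dvd card (C \<inter> K))"
  shows "card S < m * card K"
proof -
  obtain H P where H: "subgraph H G" "edges H = S" and P: "partition_on (verts H) P"
    and S: "S = (\<Union>C\<in>P. [C]\<^bsup>2\<^esup>)"
    using cl unfolding cluster_labeling_def disjoint_union_of_cliques_def by metis
  have fin: "finite (verts G)" using G by (simp add: simple_graph_def)
  then have finH: "finite (verts H)" using H(1) unfolding subgraph_def by (meson finite_subset)
  then have finP: "finite P" using P by (rule finite_elements)
  have sub: "C \<subseteq> verts G" if "C \<in> P" for C
    using that H(1) partition_onD1[OF P] unfolding subgraph_def by blast
  have clique: "\<forall>x\<in>C. \<forall>y\<in>C. x \<noteq> y \<longrightarrow> {x, y} \<in> edges G" if "C \<in> P" for C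
  proof (intro ballI impI)
    fix x y assume "x \<in> C" "y \<in> C" "x \<noteq> y"
    then have "{x, y} \<in> S" unfolding S using that by auto
    then show "{x, y} \<in> edges G" using H unfolding subgraph_def by blast
  qed
  note bound = bound[OF sub clique]
  have "card S \<le> (\<Sum>C\<in>P. card ([C]\<^bsup>2\<^esup>))"
    unfolding S by (rule card_UN_le[OF finP])
  also have "\<dots> = (\<Sum>C\<in>P. card C choose 2)"
    using sub fin by (intro sum.cong) (auto simp: finite_subset)
  finally have le: "card S \<le> (\<Sum>C\<in>P. card C choose 2)" .
  have "(\<Sum>C\<in>P. card (C \<inter> K)) = card (\<Union>C\<in>P. C \<inter> K)"
    using finP K(1) partition_onD2[OF P]
    by (intro card_UN_disjoint[symmetric]) (auto simp: disjoint_def)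
  also have "\<dots> \<le> card K" using K(1) by (intro card_mono) auto
  finally have leK: "(\<Sum>C\<in>P. card (C \<inter> K)) \<le> card K" .
  show ?thesis
  proof (cases "\<forall>C\<in>P. card C choose 2 = m * card (C \<inter> K)")
    case True
    then have "3 dvd (\<Sum>C\<in>P. card (C \<inter> K))" using bound by (intro dvd_sum) blast
    then have "(\<Sum>C\<in>P. card (C \<inter> K)) \<noteq> card K" using K(2) by metis
    then have "(\<Sum>C\<in>P. card (C \<inter> K)) < card K" using leK by simp
    moreover have "(\<Sum>C\<in>P. card C choose 2) = m * (\<Sum>C\<in>P. card (C \<inter> K))"
      using True by (simp add: sum_distrib_left)
    ultimately show ?thesis using le K(3) by (metis le_less_trans nat_mult_less_cancel1)
  next
    case False
    then obtain C where "C \<in> P" "card C choose 2 < m * card (C \<inter> K)"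
      using bound by (metis order_le_less)
    then have "(\<Sum>C\<in>P. card C choose 2) < (\<Sum>C\<in>P. m * card (C \<inter> K))"
      using finP bound by (intro sum_strict_mono_ex1) auto
    also have "\<dots> \<le> m * card K" using leK by (simp flip: sum_distrib_left)
    finally show ?thesis using le by simp
  qed
qed

lemma not_correspond_onI:
  assumes "G \<in> \<G>" "simple_graph G" "stc_set (edges G) S\<^sub>0"
    and less: "\<And>S W. cluster_labeling G S W \<Longrightarrow> card S < card S\<^sub>0"
  shows "\<not> correspond_on \<G>"
proof
  assume "correspond_on \<G>"
  then obtain S W where SW: "cluster_labeling G S W" "optimal_stc_labeling G S W"
    using assms(1) unfolding correspond_on_def by blast
  have stc0: "stc_labeling G S\<^sub>0 (edges G - S\<^sub>0)" "S\<^sub>0 \<subseteq> edges G"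
    using assms(3) by (auto simp: stc_labeling_iff stc_set_def)
  have S: "W = edges G - S" "S \<subseteq> edges G"
    using SW(1) by (auto simp: cluster_labeling_def stc_labeling_iff stc_set_def)
  have "finite (edges G)"
    using assms(2) unfolding simple_graph_def by (meson finite_imp_finite_nsets finite_subset)
  then have "card (edges G - T) + card T = card (edges G)" if "T \<subseteq> edges G" for T
    using that by (metis add.commute card_Diff_subset card_mono finite_subset le_add_diff_inverse)
  moreover have "card W \<le> card (edges G - S\<^sub>0)"
    using SW(2) stc0(1) unfolding optimal_stc_labeling_def by blast
  ultimately show False
    using less[OF SW(1)] S stc0(2) by (metis add_le_less_mono less_irrefl)
qed

section \<open>Graphs given by relations on initial segments of the natural numbers\<close>

text \<open>The injection \<open>f\<close> places a concrete graph inside an arbitrary infinite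
  vertex type, while all case analysis and computation stay with the indices below \<open>n\<close>.
  Strong edge sets are described in the same way.\<close>

definition rel_graph :: "(nat \<Rightarrow> 'a) \<Rightarrow> nat \<Rightarrow> (nat \<Rightarrow> nat \<Rightarrow> bool) \<Rightarrow> 'a graph" where
  "rel_graph f n A = Graph (f ` {..<n}) {{f i, f j} | i j. i < n \<and> j < n \<and> A i j}"

lemma verts_rel_graph [simp]: "verts (rel_graph f n A) = f ` {..<n}"
  by (simp add: rel_graph_def)

lemma edge_rel_graph_iff:
  assumes "inj f" "symp A" "i < n" "j < n"
  shows "{f i, f j} \<in> edges (rel_graph f n A) \<longleftrightarrow> A i j"
  using assms by (auto simp: rel_graph_def doubleton_eq_iff inj_eq dest: sympD)

lemma simple_graph_rel_graph:
  assumes "inj f" "irreflp A"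
  shows "simple_graph (rel_graph f n A)"
  using assms by (auto simp: simple_graph_def rel_graph_def inj_eq dest: irreflpD)

lemma rel_graph_in_free_graphsI:
  assumes f: "inj f" and A: "symp A" "irreflp A" and H: "simple_graph H"
    and no_copy: "\<And>g. inj_on g (verts H) \<Longrightarrow> \<forall>i\<in>verts H. g i < n \<Longrightarrow>
      \<forall>i\<in>verts H. \<forall>j\<in>verts H. A (g i) (g j) \<longleftrightarrow> {i, j} \<in> edges H \<Longrightarrow> False"
  shows "rel_graph f n A \<in> free_graphs H"
  unfolding free_graphs_iff[OF H]
proof (intro conjI notI, rule simple_graph_rel_graph[OF f A(2)], elim exE conjE)
  fix g assume inj: "inj_on g (verts H)" and sub: "g ` verts H \<subseteq> verts (rel_graph f n A)"
    and E: "\<forall>i\<in>verts H. \<forall>j\<in>verts H. {g i, g j} \<in> edges (rel_graph f n A) \<longleftrightarrow> {i, j} \<in> edges H"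
  obtain g' where g': "\<And>i. i \<in> verts H \<Longrightarrow> g' i < n \<and> g i = f (g' i)"
  proof -
    have "\<forall>i\<in>verts H. \<exists>k. k < n \<and> g i = f k" using sub by auto
    then show ?thesis using that by metis
  qed
  have "inj_on g' (verts H)" using inj g' by (auto simp: inj_on_def)
  moreover have "A (g' i) (g' j) \<longleftrightarrow> {i, j} \<in> edges H" if "i \<in> verts H" "j \<in> verts H" for i j
    using E edge_rel_graph_iff[OF f A(1), of "g' i" n "g' j"] g' that by auto
  ultimately show False using no_copy g' by blast
qed

lemma stc_set_rel_graph:
  assumes f: "inj f" and sym: "symp A" "symp s"
    and sA: "\<And>i j. s i j \<Longrightarrow> A i j" and closed: "\<And>i j k. \<lbrakk>i < n; j < n; k < n; i \<noteq> k; s i j; s j k\<rbrakk> \<Longrightarrow> A i k"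
  shows "stc_set (edges (rel_graph f n A)) (edges (rel_graph f n s))"
  unfolding stc_set_def
proof (intro conjI allI impI)
  show "edges (rel_graph f n s) \<subseteq> edges (rel_graph f n A)"
    using sA by (auto simp: rel_graph_def)
  have ends: "\<exists>i<n. \<exists>j<n. u = f i \<and> v = f j" if "{u, v} \<in> edges (rel_graph f n s)" for u v
    using that by (auto simp: rel_graph_def doubleton_eq_iff)
  fix u v w assume uvw: "u \<noteq> w" "{u, v} \<in> edges (rel_graph f n s)" "{v, w} \<in> edges (rel_graph f n s)"
  obtain i j where ij: "i < n" "j < n" "u = f i" "v = f j" using ends[OF uvw(2)] by blast
  obtain k where k: "k < n" "w = f k" using ends[OF uvw(3)] by blast
  have "s i j"
    using uvw(2) unfolding ij(3,4) edge_rel_graph_iff[OF f sym(2) ij(1,2)] .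
  moreover have "s j k"
    using uvw(3) unfolding ij(4) k(2) edge_rel_graph_iff[OF f sym(2) ij(2) k(1)] .
  moreover have "i \<noteq> k" using uvw(1) ij k by blast
  ultimately have "A i k" using closed ij(1,2) k(1) by blast
  then show "{u, w} \<in> edges (rel_graph f n A)"
    unfolding ij(3) k(2) edge_rel_graph_iff[OF f sym(1) ij(1) k(1)] .
qed

text \<open>Orienting each edge from the smaller to the larger index turns the count into one on
  pairs of numbers, which can be evaluated.\<close>

lemma card_edges_rel_graph:
  assumes f: "inj f" and s: "symp s" "irreflp s"
  shows "card (edges (rel_graph f n s)) = card {(i, j). i < j \<and> j < n \<and> s i j}"
proof -
  have "edges (rel_graph f n s) = (\<lambda>(i, j). {f i, f j}) ` {(i, j). i < j \<and> j < n \<and> s i j}"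
  proof (intro equalityI subsetI)
    fix e assume "e \<in> edges (rel_graph f n s)"
    then obtain i j where ij: "e = {f i, f j}" "i < n" "j < n" "s i j" by (auto simp: rel_graph_def)
    then have "i < j \<or> j < i" using irreflpD[OF s(2), of i] by (metis linorder_neqE_nat)
    then show "e \<in> (\<lambda>(i, j). {f i, f j}) ` {(i, j). i < j \<and> j < n \<and> s i j}"
    proof
      assume "i < j"
      then show ?thesis using ij by (intro image_eqI[of _ _ "(i, j)"]) auto
    next
      assume "j < i"
      then show ?thesis using ij sympD[OF s(1) ij(4)] by (intro image_eqI[of _ _ "(j, i)"]) auto
    qed
  next
    fix e assume "e \<in> (\<lambda>(i, j). {f i, f j}) ` {(i, j). i < j \<and> j < n \<and> s i j}"
    then obtain i j where "e = {f i, f j}" "i < j" "j < n" "s i j" by auto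
    then show "e \<in> edges (rel_graph f n s)" unfolding rel_graph_def graph.sel
      using order.strict_trans by blast
  qed
  moreover have "inj_on (\<lambda>(i, j). {f i, f j}) {(i, j). i < j \<and> j < n \<and> s i j}"
  proof (rule inj_onI, clarify)
    fix i j i' j' assume "{f i, f j} = {f i', f j'}" and lt: "i < j" "i' < j'"
    then have "f i = f i' \<and> f j = f j' \<or> f i = f j' \<and> f j = f i'" by (simp add: doubleton_eq_iff)
    then show "i = i' \<and> j = j'" using lt by (auto simp: inj_eq[OF f])
  qed
  ultimately show ?thesis by (simp add: card_image)
qed

section \<open>The complement of \<open>C\<^sub>7\<close>\<close>

text \<open>The vertices \<open>0, \<dots>, 6\<close> are arranged around the 7-cycle; cyclic differences \<open>\<plusminus>1\<close> and
  \<open>\<plusminus>2\<close> are written additively, so both relations make sense below \<open>7\<close> only.\<close>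

definition C7_complement_adj :: "nat \<Rightarrow> nat \<Rightarrow> bool" where
  "C7_complement_adj i j \<longleftrightarrow> i \<noteq> j \<and> i + 1 \<noteq> j \<and> j + 1 \<noteq> i \<and> i + 6 \<noteq> j \<and> j + 6 \<noteq> i"

definition C7_complement_strong :: "nat \<Rightarrow> nat \<Rightarrow> bool" where
  "C7_complement_strong i j \<longleftrightarrow> i + 2 = j \<or> j + 2 = i \<or> i + 5 = j \<or> j + 5 = i"

abbreviation C7_complement :: "(nat \<Rightarrow> 'a) \<Rightarrow> 'a graph" where
  "C7_complement f \<equiv> rel_graph f 7 C7_complement_adj"

lemma C7_complement_adj_sym: "symp C7_complement_adj"
  and C7_complement_adj_irrefl: "irreflp C7_complement_adj"
  by (auto simp: symp_def irreflp_def C7_complement_adj_def)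

lemma C7_complement_strong_sym: "symp C7_complement_strong"
  and C7_complement_strong_irrefl: "irreflp C7_complement_strong"
  by (auto simp: symp_def irreflp_def C7_complement_strong_def)

lemma C7_complement_strong_imp_adj: "C7_complement_strong i j \<Longrightarrow> C7_complement_adj i j"
  by (auto simp: C7_complement_strong_def C7_complement_adj_def)

text \<open>The only non-neighbours of \<open>j\<close> besides itself are its successor and
  predecessor on the cycle; the conditionals treat the wrap-around.\<close>

lemma C7_complement_nonadj:
  assumes "\<not> C7_complement_adj i j" "i \<noteq> j" "i < 7" "j < 7"
  shows "i = (if j = 6 then 0 else j + 1) \<or> i = (if j = 0 then 6 else j - 1)"
  using assms by (auto simp: C7_complement_adj_def split: if_splits)

text \<open>Otherwise \<open>a\<close> and \<open>b\<close> would be the two cycle neighbours of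
  \<open>c\<close>; these are at cyclic distance two and so adjacent in the complement.\<close>

lemma C7_complement_3K1_free:
  assumes lt: "a < 7" "b < 7" "c < 7" and dist: "distinct [a, b, c]"
  shows "C7_complement_adj a b \<or> C7_complement_adj a c \<or> C7_complement_adj b c"
proof (rule ccontr)
  assume "\<not> ?thesis"
  then have "\<not> C7_complement_adj a c" "\<not> C7_complement_adj b c" "\<not> C7_complement_adj a b"
    by blast+
  moreover have "a \<noteq> c" "b \<noteq> c" "a \<noteq> b" using dist by simp_all
  ultimately have "a = (if c = 6 then 0 else c + 1) \<and> b = (if c = 0 then 6 else c - 1) \<or>
      b = (if c = 6 then 0 else c + 1) \<and> a = (if c = 0 then 6 else c - 1)"
    using C7_complement_nonadj[of a c] C7_complement_nonadj[of b c] lt by metis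
  then have "C7_complement_adj a b"
    using lt unfolding C7_complement_adj_def by (elim disjE conjE) (auto split: if_splits)
  then show False using \<open>\<not> C7_complement_adj a b\<close> by blast
qed

text \<open>The vertex \<open>d\<close> has only two cycle neighbours, too few for three distinct
  non-neighbours.\<close>

lemma C7_complement_co_claw_free:
  assumes "a < 7" "b < 7" "c < 7" "d < 7" "distinct [a, b, c, d]"
  shows "C7_complement_adj a d \<or> C7_complement_adj b d \<or> C7_complement_adj c d"
  using assms C7_complement_nonadj[of a d] C7_complement_nonadj[of b d] C7_complement_nonadj[of c d]
  by (metis distinct_length_2_or_more)

text \<open>Otherwise \<open>c\<close> and \<open>d\<close> would both have \<open>a\<close> and
  \<open>b\<close> as their cycle neighbours, but on a 7-cycle the two neighbours determine the
  vertex.\<close>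

lemma C7_complement_2K2_free:
  assumes lt: "a < 7" "b < 7" "c < 7" "d < 7" and dist: "distinct [a, b, c, d]"
  shows "C7_complement_adj a c \<or> C7_complement_adj a d \<or> C7_complement_adj b c \<or> C7_complement_adj b d"
proof (rule ccontr)
  assume "\<not> ?thesis"
  then have "\<not> C7_complement_adj a c" "\<not> C7_complement_adj b c"
    "\<not> C7_complement_adj a d" "\<not> C7_complement_adj b d"
    by blast+
  moreover have "a \<noteq> c" "b \<noteq> c" "a \<noteq> d" "b \<noteq> d" "a \<noteq> b" "c \<noteq> d" using dist by simp_all
  ultimately have "a = (if c = 6 then 0 else c + 1) \<and> b = (if c = 0 then 6 else c - 1) \<or>
      b = (if c = 6 then 0 else c + 1) \<and> a = (if c = 0 then 6 else c - 1)"
    "a = (if d = 6 then 0 else d + 1) \<and> b = (if d = 0 then 6 else d - 1) \<or>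
      b = (if d = 6 then 0 else d + 1) \<and> a = (if d = 0 then 6 else d - 1)"
    using C7_complement_nonadj[of a c] C7_complement_nonadj[of b c]
      C7_complement_nonadj[of a d] C7_complement_nonadj[of b d] lt by metis+
  then show False
    using lt \<open>c \<noteq> d\<close> by (elim disjE conjE) (simp_all split: if_splits)
qed

text \<open>Two steps of cyclic length two lead back to the start or to cyclic distance three, never
  to distance one.\<close>

lemma C7_complement_strong_stc:
  assumes "i < 7" "j < 7" "k < 7" "i \<noteq> k" "C7_complement_strong i j" "C7_complement_strong j k"
  shows "C7_complement_adj i k"
  using assms unfolding C7_complement_adj_def C7_complement_strong_def by (elim disjE) auto

lemma card_C7_complement_strong: "card {(i, j). i < j \<and> j < 7 \<and> C7_complement_strong i j} = 7"
proof -
  have "{(i, j). i < j \<and> j < 7 \<and> C7_complement_strong i j} =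
      Set.filter (\<lambda>(i, j). i < j \<and> C7_complement_strong i j) ({0..<7} \<times> {0..<7})"
    by force
  moreover have "card (Set.filter (\<lambda>(i, j). i < j \<and> C7_complement_strong i j) ({0..<7} \<times> {0..<7})) = 7"
    by code_simp
  ultimately show ?thesis by metis
qed

text \<open>Put in increasing order, four pairwise adjacent vertices have three gaps of at least
  \<open>2\<close>, so the extremes differ by at least \<open>6\<close>; but a difference of
  \<open>6\<close> is adjacency on the cycle.\<close>

lemma C7_complement_K4_free:
  assumes "a < 7" "b < 7" "c < 7" "d < 7" "C7_complement_adj a b" "C7_complement_adj a c"
    "C7_complement_adj a d" "C7_complement_adj b c" "C7_complement_adj b d"
  shows "\<not> C7_complement_adj c d"
proof
  assume "C7_complement_adj c d"
  have le: "x + 2 \<le> y \<and> y < x + 6" if "x \<le> y" "C7_complement_adj x y" "y < 7" for x y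
    using that unfolding C7_complement_adj_def by linarith
  have False if "w \<le> x" "x \<le> y" "y \<le> z" "z < 7" "C7_complement_adj w x" "C7_complement_adj x y"
    "C7_complement_adj y z" "C7_complement_adj w z" for w x y z
    using le[of w x] le[of x y] le[of y z] le[of w z] that by linarith
  then show False
    using assms \<open>C7_complement_adj c d\<close> sympD[OF C7_complement_adj_sym] by (smt (verit) linorder_linear)
qed

lemma simple_graph_C7_complement: "inj f \<Longrightarrow> simple_graph (C7_complement f)"
  by (intro simple_graph_rel_graph C7_complement_adj_irrefl)

text \<open>All listed graphs except \<open>two_K2\<close>, \<open>complete_graph 4\<close> and
  \<open>co_claw\<close> contain three independent vertices, so a single fact excludes them.\<close>

lemma C7_complement_free:
  assumes f: "inj f"
    and H: "H \<in> {edgeless_graph 3, two_K2, co_paw, co_diamond, complete_graph 4, edgeless_graph 4, claw, co_claw}"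
  shows "C7_complement f \<in> free_graphs H"
proof (rule rel_graph_in_free_graphsI[OF f C7_complement_adj_sym C7_complement_adj_irrefl])
  show "simple_graph H"
    using H simple_small_graphs simple_complete_graph by auto
  fix g assume inj: "inj_on g (verts H)" and lt: "\<forall>i\<in>verts H. g i < 7"
    and adj: "\<forall>i\<in>verts H. \<forall>j\<in>verts H. C7_complement_adj (g i) (g j) \<longleftrightarrow> {i, j} \<in> edges H"
  have three: False if ijk: "{i, j, k} \<subseteq> verts H" "distinct [i, j, k]"
    and no: "{i, j} \<notin> edges H" "{i, k} \<notin> edges H" "{j, k} \<notin> edges H" for i j k
  proof -
    have "distinct [g i, g j, g k]" using ijk inj_onD[OF inj] by auto
    moreover have "g i < 7" "g j < 7" "g k < 7" using ijk(1) lt by auto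
    ultimately show False
      using C7_complement_3K1_free[of "g i" "g j" "g k"] adj ijk(1) no by (simp add: subset_iff)
  qed
  from H consider "H = edgeless_graph 3 \<or> H = edgeless_graph 4" | "H = co_paw \<or> H = co_diamond" | "H = claw"
    | "H = two_K2" | "H = complete_graph 4" | "H = co_claw" by blast
  then show False
  proof cases
    case 1
    then have "{0, 1, 2} \<subseteq> verts H" "edges H = {}"
      by (auto simp: edgeless_graph_3 edgeless_graph_4)
    then show False using three[of 0 1 2] by simp
  next
    case 2
    then have "{0, 2, 3} \<subseteq> verts H" "{0, 2} \<notin> edges H" "{0, 3} \<notin> edges H" "{2, 3} \<notin> edges H"
      by (auto simp: co_paw_def co_diamond_def doubleton_eq_iff)
    then show False using three[of 0 2 3] by simp
  next
    case 3
    then have "{1, 2, 3} \<subseteq> verts H" "{1, 2} \<notin> edges H" "{1, 3} \<notin> edges H" "{2, 3} \<notin> edges H"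
      by (auto simp: claw_def doubleton_eq_iff)
    then show False using three[of 1 2 3] by simp
  next
    case 4
    then have "distinct [g 0, g 1, g 2, g 3]" "g 0 < 7" "g 1 < 7" "g 2 < 7" "g 3 < 7"
      using inj lt by (simp_all add: two_K2_def eq_commute)
    then show False
      using C7_complement_2K2_free[of "g 0" "g 1" "g 2" "g 3"] adj 4
      by (simp add: two_K2_def doubleton_eq_iff)
  next
    case 5
    then have "g 0 < 7" "g 1 < 7" "g 2 < 7" "g 3 < 7"
      using lt by (simp_all add: complete_graph_def)
    then show False
      using C7_complement_K4_free[of "g 0" "g 1" "g 2" "g 3"] adj 5
      by (simp add: complete_graph_def)
  next
    case 6
    then have "distinct [g 0, g 1, g 2, g 3]" "g 0 < 7" "g 1 < 7" "g 2 < 7" "g 3 < 7"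
      using inj lt by (simp_all add: co_claw_def eq_commute)
    then show False
      using C7_complement_co_claw_free[of "g 0" "g 1" "g 2" "g 3"] adj 6
      by (simp add: co_claw_def doubleton_eq_iff)
  qed
qed

text \<open>The counting bound is used with all seven vertices and \<open>m = 1\<close>: cliques of
  size \<open>0, 1, 2, 3\<close> have \<open>0, 0, 1, 3\<close> edges, so only the empty clique and
  triangles are tight.\<close>

lemma not_correspond_on_C7_complement:
  assumes f: "inj f" and in\<G>: "C7_complement f \<in> \<G>"
  shows "\<not> correspond_on \<G>"
proof (rule not_correspond_onI[OF in\<G> simple_graph_C7_complement[OF f]])
  let ?G = "C7_complement f"
  show "stc_set (edges ?G) (edges (rel_graph f 7 C7_complement_strong))"
    by (rule stc_set_rel_graph[OF f C7_complement_adj_sym C7_complement_strong_sym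
          C7_complement_strong_imp_adj C7_complement_strong_stc])
  fix S W assume "cluster_labeling ?G S W"
  then have "card S < 1 * card (f ` {..<7})"
  proof (rule cluster_labeling_card_less[OF simple_graph_C7_complement[OF f]])
    show "finite (f ` {..<7})" "(0 :: nat) < 1" by simp_all
    show "\<not> 3 dvd card (f ` {..<7})" using f by (simp add: card_image inj_on_subset)
    fix C assume C: "C \<subseteq> verts ?G" and clique: "\<forall>x\<in>C. \<forall>y\<in>C. x \<noteq> y \<longrightarrow> {x, y} \<in> edges ?G"
    have "card C \<le> 3"
    proof (rule ccontr)
      assume "\<not> card C \<le> 3"
      then have "4 \<le> card C" by simp
      then obtain U where U: "U \<subseteq> C" "card U = 4" "finite U" by (rule obtain_subset_with_card_n)
      then obtain h where h: "bij_betw h {..<4 :: nat} U"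
        using ex_bij_betw_nat_finite[of U] by (metis atLeast0LessThan)
      have no_loop: "{x} \<notin> edges ?G" "{i} \<notin> edges (complete_graph n)" for x i n
        using simple_graph_edgeD(3)[OF simple_graph_C7_complement[OF f], of x x]
          simple_graph_edgeD(3)[OF simple_complete_graph, of i i n] by auto
      have "?G \<in> free_graphs (complete_graph 4)"
        by (rule C7_complement_free[OF f]) simp
      then show False
      proof (rule free_graphsD[OF _ simple_complete_graph])
        show "inj_on h (verts (complete_graph 4))" "h ` verts (complete_graph 4) \<subseteq> verts ?G"
          using h U(1) C by (auto simp: bij_betw_def complete_graph_def)
        fix i j assume "i \<in> verts (complete_graph 4)" "j \<in> verts (complete_graph 4)"
        then have ij: "i < 4" "j < 4" by (simp_all add: complete_graph_def)
        then have "h i \<in> C" "h j \<in> C" "h i = h j \<longleftrightarrow> i = j"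
          using h U(1) by (auto simp: bij_betw_def inj_on_def)
        then show "{h i, h j} \<in> edges ?G \<longleftrightarrow> {i, j} \<in> edges (complete_graph 4)"
          using clique ij by (cases "i = j") (simp_all add: no_loop, simp add: complete_graph_def)
      qed
    qed
    then consider "card C = 0" | "card C = 1" | "card C = 2" | "card C = 3" by linarith
    moreover have "C \<inter> f ` {..<7} = C" using C by auto
    ultimately show "card C choose 2 \<le> 1 * card (C \<inter> f ` {..<7}) \<and>
      (card C choose 2 = 1 * card (C \<inter> f ` {..<7}) \<longrightarrow> 3 dvd card (C \<inter> f ` {..<7}))"
      by cases (simp_all add: choose_two)
  qed
  also have "card (f ` {..<7}) = 7"
    using f by (simp add: card_image inj_on_subset)
  finally show "card S < card (edges (rel_graph f 7 C7_complement_strong))"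
    using card_edges_rel_graph[OF f C7_complement_strong_sym C7_complement_strong_irrefl, of 7]
    by (simp add: card_C7_complement_strong)
qed

section \<open>A complete graph on four vertices with ears\<close>

text \<open>Four outer vertices \<open>4, \<dots>, 7\<close> are attached to the clique \<open>{0, \<dots>, 3}\<close>;
  the outer vertex \<open>4 + i\<close> misses exactly \<open>i\<close>.\<close>

definition K4_with_ears_adj :: "nat \<Rightarrow> nat \<Rightarrow> bool" where
  "K4_with_ears_adj i j \<longleftrightarrow> i \<noteq> j \<and> (i < 4 \<or> j < 4) \<and> i + 4 \<noteq> j \<and> j + 4 \<noteq> i"

text \<open>A 4-cycle through the clique, and at each clique vertex \<open>i\<close> the ear that misses the vertex
  opposite to \<open>i\<close> on that cycle.\<close>

definition K4_with_ears_arc :: "nat \<Rightarrow> nat \<Rightarrow> bool" where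
  "K4_with_ears_arc i j \<longleftrightarrow> i < 4 \<and>
    (if j < 4 then i + 1 = j \<or> i = j + 3 else i + 6 = j \<or> i + 2 = j)"

definition K4_with_ears_strong :: "nat \<Rightarrow> nat \<Rightarrow> bool" where
  "K4_with_ears_strong i j \<longleftrightarrow> K4_with_ears_arc i j \<or> K4_with_ears_arc j i"

abbreviation K4_with_ears :: "(nat \<Rightarrow> 'a) \<Rightarrow> 'a graph" where
  "K4_with_ears f \<equiv> rel_graph f 8 K4_with_ears_adj"

lemma K4_with_ears_adj_sym: "symp K4_with_ears_adj" and K4_with_ears_adj_irrefl: "irreflp K4_with_ears_adj"
  by (auto simp: symp_def irreflp_def K4_with_ears_adj_def)

lemma K4_with_ears_strong_imp_adj: "K4_with_ears_strong i j \<Longrightarrow> K4_with_ears_adj i j"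
  by (auto simp: K4_with_ears_strong_def K4_with_ears_arc_def K4_with_ears_adj_def split: if_splits)

lemma K4_with_ears_strong_sym: "symp K4_with_ears_strong" and K4_with_ears_strong_irrefl: "irreflp K4_with_ears_strong"
  using K4_with_ears_strong_imp_adj K4_with_ears_adj_irrefl
  by (auto simp: symp_def irreflp_def K4_with_ears_strong_def)

text \<open>The strong neighbours of a clique vertex are its two cycle neighbours and an ear missing
  only the opposite vertex, so they are mutually adjacent. An ear has a single strong
  neighbour.\<close>

lemma K4_with_ears_strong_stc:
  assumes "i < 8" "j < 8" "k < 8" "i \<noteq> k" "K4_with_ears_strong i j" "K4_with_ears_strong j k"
  shows "K4_with_ears_adj i k"
  using assms unfolding K4_with_ears_strong_def K4_with_ears_arc_def K4_with_ears_adj_def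
  by (elim disjE conjE) (auto split: if_splits)

lemma card_K4_with_ears_strong: "card {(i, j). i < j \<and> j < 8 \<and> K4_with_ears_strong i j} = 8"
proof -
  have "{(i, j). i < j \<and> j < 8 \<and> K4_with_ears_strong i j} =
      Set.filter (\<lambda>(i, j). i < j \<and> K4_with_ears_strong i j) ({0..<8} \<times> {0..<8})"
    by force
  moreover have "card (Set.filter (\<lambda>(i, j). i < j \<and> K4_with_ears_strong i j) ({0..<8} \<times> {0..<8})) = 8"
    by code_simp
  ultimately show ?thesis by metis
qed

lemma simple_graph_K4_with_ears: "inj f \<Longrightarrow> simple_graph (K4_with_ears f)"
  by (intro simple_graph_rel_graph K4_with_ears_adj_irrefl)

text \<open>Each diagonal of an induced 4-cycle is a non-adjacent pair and so contains an ear; ears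
  from different diagonals would be adjacent on the cycle, but no two ears are adjacent.\<close>

lemma K4_with_ears_C4_free:
  assumes f: "inj f"
  shows "K4_with_ears f \<in> free_graphs C4"
proof (rule rel_graph_in_free_graphsI[OF f K4_with_ears_adj_sym K4_with_ears_adj_irrefl simple_small_graphs(6)])
  fix g assume inj: "inj_on g (verts C4)"
    and adj: "\<forall>i\<in>verts C4. \<forall>j\<in>verts C4. K4_with_ears_adj (g i) (g j) \<longleftrightarrow> {i, j} \<in> edges C4"
  have ear: "4 \<le> i \<or> 4 \<le> j" if "\<not> K4_with_ears_adj i j" "i \<noteq> j" for i j
    using that by (auto simp: K4_with_ears_adj_def)
  have core: "i < 4 \<or> j < 4" if "K4_with_ears_adj i j" for i j
    using that by (simp add: K4_with_ears_adj_def)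
  from adj have "K4_with_ears_adj (g 0) (g 1)" "K4_with_ears_adj (g 1) (g 2)" "K4_with_ears_adj (g 2) (g 3)"
    "K4_with_ears_adj (g 3) (g 0)" "\<not> K4_with_ears_adj (g 0) (g 2)" "\<not> K4_with_ears_adj (g 1) (g 3)"
    by (simp_all add: C4_def doubleton_eq_iff)
  moreover have "g 0 \<noteq> g 2" "g 1 \<noteq> g 3" using inj by (simp_all add: C4_def)
  ultimately show False
    using ear[of "g 0" "g 2"] ear[of "g 1" "g 3"] core[of "g 0" "g 1"] core[of "g 1" "g 2"]
      core[of "g 2" "g 3"] core[of "g 3" "g 0"] by linarith
qed

text \<open>Clusters are charged to the core clique with \<open>m = 2\<close>. A cluster has at most
  one ear, and none if it contains the whole core. With \<open>0, 1, 2, 3, 4\<close> core vertices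
  it thus has at most \<open>0, 1, 3, 6, 6\<close> edges, against the bounds
  \<open>0, 2, 4, 6, 8\<close>.\<close>

lemma not_correspond_on_K4_with_ears:
  assumes f: "inj f" and in\<G>: "K4_with_ears f \<in> \<G>"
  shows "\<not> correspond_on \<G>"
proof (rule not_correspond_onI[OF in\<G> simple_graph_K4_with_ears[OF f]])
  let ?G = "K4_with_ears f" and ?K = "f ` {..<4}"
  show "stc_set (edges ?G) (edges (rel_graph f 8 K4_with_ears_strong))"
    by (rule stc_set_rel_graph[OF f K4_with_ears_adj_sym K4_with_ears_strong_sym
          K4_with_ears_strong_imp_adj K4_with_ears_strong_stc])
  have card_K: "card ?K = 4" using f by (simp add: card_image inj_on_subset)
  fix S W assume "cluster_labeling ?G S W"
  then have "card S < 2 * card ?K"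
  proof (rule cluster_labeling_card_less[OF simple_graph_K4_with_ears[OF f]])
    show "finite ?K" "(0 :: nat) < 2" by simp_all
    show "\<not> 3 dvd card ?K" by (simp add: card_K)
    fix C assume C: "C \<subseteq> verts ?G" and clique: "\<forall>x\<in>C. \<forall>y\<in>C. x \<noteq> y \<longrightarrow> {x, y} \<in> edges ?G"
    have finC: "finite C" using C by (simp add: finite_subset)
    have adj: "K4_with_ears_adj i j" if "f i \<in> C" "f j \<in> C" "i \<noteq> j" "i < 8" "j < 8" for i j
      using clique that edge_rel_graph_iff[OF f K4_with_ears_adj_sym that(4,5)] inj_eq[OF f] by metis
    have ear: "\<exists>i<8. x = f i \<and> 4 \<le> i" if "x \<in> C - ?K" for x
    proof -
      have "x \<in> f ` {..<8}" using C that by auto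
      then obtain i where "i < 8" "x = f i" by blast
      then show ?thesis using that by (metis DiffD2 image_eqI lessThan_iff linorder_not_le)
    qed
    have "x = y" if x: "x \<in> C - ?K" and y: "y \<in> C - ?K" for x y
    proof (rule ccontr)
      assume "x \<noteq> y"
      obtain i where i: "i < 8" "x = f i" "4 \<le> i" using ear[OF x] by blast
      obtain j where j: "j < 8" "y = f j" "4 \<le> j" using ear[OF y] by blast
      have "K4_with_ears_adj i j" using adj[of i j] i j x y \<open>x \<noteq> y\<close> by blast
      then show False using i(3) j(3) by (simp add: K4_with_ears_adj_def)
    qed
    then have "card (C - ?K) \<le> 1"
      using finC card_le_Suc0_iff_eq[of "C - ?K"] by simp
    moreover have "card (C - ?K) = 0" if "card (C \<inter> ?K) = 4"
    proof -
      have "C \<inter> ?K = ?K" using that card_K by (intro card_subset_eq) auto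
      then have "x \<notin> C - ?K" for x
      proof (intro notI)
        assume K: "C \<inter> ?K = ?K" and x: "x \<in> C - ?K"
        obtain i where i: "i < 8" "x = f i" "4 \<le> i" using ear[OF x] by blast
        \<comment> \<open>The ear with index \<open>i\<close> misses the core vertex with index
          \<open>i - 4\<close>, which lies in \<open>C\<close> when the whole core does.\<close>
        have "f (i - 4) \<in> ?K" using i by (intro imageI) simp
        then have "f (i - 4) \<in> C" using K by blast
        then have "K4_with_ears_adj i (i - 4)" using adj[of i "i - 4"] i x by simp
        then show False using i(3) by (simp add: K4_with_ears_adj_def)
      qed
      then show ?thesis by (metis card.empty ex_in_conv)
    qed
    moreover have "card C = card (C \<inter> ?K) + card (C - ?K)"
      using card_Int_Diff[OF finC] .
    moreover have "card (C \<inter> ?K) \<le> 4"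
      using card_mono[of ?K "C \<inter> ?K"] card_K by simp
    ultimately consider "card (C \<inter> ?K) = 0" "card C \<le> 1" | "card (C \<inter> ?K) = 1" "card C \<le> 2"
      | "card (C \<inter> ?K) = 2" "card C \<le> 3" | "card (C \<inter> ?K) = 3" "card C \<le> 4" | "card (C \<inter> ?K) = 4" "card C \<le> 4"
      by linarith
    then show "card C choose 2 \<le> 2 * card (C \<inter> ?K) \<and>
      (card C choose 2 = 2 * card (C \<inter> ?K) \<longrightarrow> 3 dvd card (C \<inter> ?K))"
    proof cases
      case 1
      then show ?thesis using binomial_right_mono[OF 1(2), of 2] by (simp add: choose_two)
    next
      case 2
      then show ?thesis using binomial_right_mono[OF 2(2), of 2] by (simp add: choose_two)
    next
      case 3
      then show ?thesis using binomial_right_mono[OF 3(2), of 2] by (simp add: choose_two)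
    next
      case 4
      then show ?thesis using binomial_right_mono[OF 4(2), of 2] by (simp add: choose_two)
    next
      case 5
      then show ?thesis using binomial_right_mono[OF 5(2), of 2] by (simp add: choose_two)
    qed
  qed
  then show "card S < card (edges (rel_graph f 8 K4_with_ears_strong))"
    using card_edges_rel_graph[OF f K4_with_ears_strong_sym K4_with_ears_strong_irrefl, of 8]
    by (simp add: card_K4_with_ears_strong card_K)
qed

theorem theorem6:
  shows "(\<forall>H \<in> {edgeless_graph 3, C4, two_K2, co_paw, co_diamond, complete_graph 4,
                edgeless_graph 4, claw, co_claw}.
            \<not> correspond_on (free_graphs H :: 'a::infinite graph set)) \<and>
         (\<forall>H \<in> {complete_graph 3, path_graph 3, K2_plus_K1, path_graph 4, diamond, paw}.
            correspond_on (free_graphs H :: 'b graph set))"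
proof (intro conjI ballI)
  \<comment> \<open>Infinitely many vertices are available, so both counterexamples, with 7 and 8
    vertices, can be placed by the same injection.\<close>
  obtain f :: "nat \<Rightarrow> 'a" where f: "inj f"
    using arb_countable_map[of "{}"] by blast
  fix H assume "H \<in> {edgeless_graph 3, C4, two_K2, co_paw, co_diamond, complete_graph 4,
      edgeless_graph 4, claw, co_claw}"
  then consider "H = C4" | "H \<in> {edgeless_graph 3, two_K2, co_paw, co_diamond, complete_graph 4,
      edgeless_graph 4, claw, co_claw}" by blast
  then show "\<not> correspond_on (free_graphs H :: 'a graph set)"
  proof cases
    case 1
    then show ?thesis using not_correspond_on_K4_with_ears[OF f] K4_with_ears_C4_free[OF f] by blast
  next
    case 2
    then show ?thesis using not_correspond_on_C7_complement[OF f] C7_complement_free[OF f] by blast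
  qed
next
  fix H assume "H \<in> {complete_graph 3, path_graph 3, K2_plus_K1, path_graph 4, diamond, paw}"
  then consider "H \<in> {complete_graph 3, diamond}" | "H \<in> {path_graph 3, K2_plus_K1, path_graph 4}"
    | "H = paw" by blast
  then show "correspond_on (free_graphs H :: 'b graph set)"
    by cases (use correspond_on_diamond_free correspond_on_P4_free correspond_on_paw_free in blast)+
qed

end
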